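(* Let $2\le r\le k$ and $C\ge 1$ be integers. Let $\mathcal{H}_N$ be a sequence of (possibly weighted) $k$-uniform hypergraphs with $V(\mathcal{H}_N)=[N]$, $\Delta_r(\mathcal{H}_N)\le C$ and $\sigma^2(\mathcal{H}_N)\ge N^{2r-2}/C$ for all $N$. Let $p=p_N$ be a sequence which is either a constant in $(0,1/2)$ or converges to $0$ (with $p_N\in(0,1/2)$), and let $\delta_N$ be a sequence such that $$\sqrt{\frac{\log N}{pN}}\ \ll\ \delta_N\ \ll\ p^{(k-r)/(2(r-1))}.$$ Then $$\mathbb{P}\left(D^{\mathcal{H}_N}(B_p)\ge \delta_N p^k e(\mathcal{H}_N)\right)=\exp\left(\frac{-(1+o(1))\,\delta_N^2\, p\, e(\mathcal{H}_N)^2}{2(1-p)\big(\bar d(\mathcal{H}_N)^2+\sigma^2(\mathcal{H}_N)\big)N}\right).$$ Furthermore, the same formula holds for the lower tail probability $\mathbb{P}\left(D^{\mathcal{H}_N}(B_p)\le -\delta_N p^k e(\mathcal{H}_N)\right)$.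
   Context: $[N]=\{1,\dots,N\}$. Sequences are indexed by $N$ (all sufficiently large positive integers), and asymptotics are as $N\to\infty$: $a_N\ll b_N$ means $a_N/b_N\to 0$, and $o(1)$ denotes a quantity tending to $0$. A weighted $k$-uniform hypergraph $\mathcal{H}$ on $[N]$ has a positive weight attached to each edge (unweighted: all weights $1$); all parameters count edges with weight. $e(\mathcal{H})$ is the total weight of all edges; for $R\subseteq[N]$, $d_{\mathcal{H}}(R)$ is the total weight of edges containing $R$, and $d_{\mathcal{H}}(x)=d_{\mathcal{H}}(\{x\})$. Set $\Delta_r(\mathcal{H})=\max\{d_{\mathcal{H}}(R):|R|=r\}$, $\bar d(\mathcal{H})=\frac1N\sum_{x=1}^N d_{\mathcal{H}}(x)=k\,e(\mathcal{H})/N$, and $\sigma^2(\mathcal{H})=\frac1N\sum_{x=1}^N (d_{\mathcal{H}}(x)-\bar d(\mathcal{H}))^2$. $B_p\subseteq[N]$ is the random set in which each element of $[N]$ is included independently with probability $p$. For $B\subseteq[N]$, $N^{\mathcal{H}}(B)=e(\mathcal{H}[B])$ is the total weight of edges of $\mathcal{H}$ contained in $B$, and $D^{\mathcal{H}}(B_p)=N^{\mathcal{H}}(B_p)-p^k e(\mathcal{H})$ is the deviation from the mean. *)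

theory Defs
  imports "HOL-Probability.Probability"
begin

text \<open>The values of the weight function outside the edge set are irrelevant: every parameter
  below only sums over edges.\<close>

record weighted_hypergraph =
  edges :: "nat set set"
  weight :: "nat set \<Rightarrow> real"

definition uniform_on :: "nat \<Rightarrow> nat \<Rightarrow> weighted_hypergraph \<Rightarrow> bool" where
  "uniform_on k N H \<longleftrightarrow>
     (\<forall>e\<in>edges H. e \<subseteq> {1..N} \<and> card e = k \<and> weight H e > 0)"

definition total_weight :: "weighted_hypergraph \<Rightarrow> real" where
  "total_weight H = (\<Sum>e\<in>edges H. weight H e)"

definition set_degree :: "weighted_hypergraph \<Rightarrow> nat set \<Rightarrow> real" where
  "set_degree H R = (\<Sum>e | e \<in> edges H \<and> R \<subseteq> e. weight H e)"

text \<open>Meaningful only for \<^term>\<open>r \<le> N\<close>; otherwise this is the maximum of the empty set.\<close>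

definition max_degree :: "nat \<Rightarrow> nat \<Rightarrow> weighted_hypergraph \<Rightarrow> real" where
  "max_degree r N H = Max {set_degree H R |R. R \<subseteq> {1..N} \<and> card R = r}"

definition avg_degree :: "nat \<Rightarrow> weighted_hypergraph \<Rightarrow> real" where
  "avg_degree N H = (\<Sum>x\<in>{1..N}. set_degree H {x}) / real N"

definition degree_variance :: "nat \<Rightarrow> weighted_hypergraph \<Rightarrow> real" where
  "degree_variance N H =
     (\<Sum>x\<in>{1..N}. (set_degree H {x} - avg_degree N H)\<^sup>2) / real N"

definition random_subset :: "nat \<Rightarrow> real \<Rightarrow> nat set pmf" where
  "random_subset N p =
     map_pmf (\<lambda>f. {x\<in>{1..N}. f x}) (Pi_pmf {1..N} False (\<lambda>_. bernoulli_pmf p))"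

definition weight_inside :: "weighted_hypergraph \<Rightarrow> nat set \<Rightarrow> real" where
  "weight_inside H B = (\<Sum>e | e \<in> edges H \<and> e \<subseteq> B. weight H e)"

definition deviation :: "nat \<Rightarrow> real \<Rightarrow> weighted_hypergraph \<Rightarrow> nat set \<Rightarrow> real" where
  "deviation k p H B = weight_inside H B - p ^ k * total_weight H"

definition much_smaller :: "(nat \<Rightarrow> real) \<Rightarrow> (nat \<Rightarrow> real) \<Rightarrow> bool" where
  "much_smaller a b \<longleftrightarrow> (\<lambda>N. a N / b N) \<longlonglongrightarrow> 0"

end

theory Submission
  imports Defs
begin

text \<open>Exposing the vertices one at a time, the deviation is a martingale
  \<open>\<Sum>i. (\<xi> i - p) * X i\<close>, where \<open>X i\<close> is the conditional expectation of the degree of \<open>i\<close> into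
  the random set, given the vertices before \<open>i\<close>. If every \<open>X i\<close> is at most
  \<open>p ^ (k - 1) * (d i + \<eta> * N ^ (r - 1))\<close>, the exponential moment of the sum is the Gaussian one up
  to a factor \<open>1 + O(\<eta>)\<close> in the exponent, which gives the upper bound for both tails. That \<open>X i\<close>
  exceeds this threshold is superexponentially unlikely: its moment of order
  \<open>M \<approx> K \<delta>\<^sup>2 p N\<close> is at most \<open>(p ^ (k - 1) * (d i + o(N ^ (r - 1)))) ^ M\<close>, because
  \<open>O(M)\<close> vertices that are already occupied can raise the expected degree of \<open>i\<close> only by
  \<open>O(M ^ (r - 1))\<close>, and \<open>M ^ (r - 1) \<lless> p ^ (k - 1) * N ^ (r - 1)\<close> is exactly the upper bound on \<open>\<delta>\<close>.

  For the lower bound, the inclusion probability of \<open>x\<close> is tilted to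
  \<open>p * (1 \<plusminus> c * d x)\<close> with \<open>c = (1 + \<eta>) \<delta> e(H) / \<Sum>x. (d x)\<^sup>2\<close>. Under the tilted measure the
  deviation is typical by Chebyshev's inequality, and the relative entropy of the tilt is
  \<open>(1 + \<eta>)\<^sup>2\<close> times the claimed rate. The two tails differ only by a sign \<open>\<sigma>\<close>.\<close>

section \<open>Independent inclusion with varying probabilities\<close>

text \<open>\<open>bexp q n f\<close> is the expectation of \<open>f B\<close> for the random \<open>B \<subseteq> {1..n}\<close> that contains each
  \<open>i\<close> independently with probability \<open>q i\<close>.\<close>

primrec bexp :: "(nat \<Rightarrow> real) \<Rightarrow> nat \<Rightarrow> (nat set \<Rightarrow> real) \<Rightarrow> real" where
  "bexp q 0 f = f {}"
| "bexp q (Suc n) f =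
     bexp q n (\<lambda>B. (1 - q (Suc n)) * f B + q (Suc n) * f (insert (Suc n) B))"

lemma bexp_mono:
  assumes "\<And>B. B \<subseteq> {1..n} \<Longrightarrow> f B \<le> g B" and "\<And>i. i \<in> {1..n} \<Longrightarrow> 0 \<le> q i \<and> q i \<le> 1"
  shows "bexp q n f \<le> bexp q n g"
  using assms
proof (induction n arbitrary: f g)
  case (Suc n)
  have "0 \<le> q (Suc n)" "q (Suc n) \<le> 1"
    using Suc.prems(2)[of "Suc n"] by auto
  moreover have "f B \<le> g B" "f (insert (Suc n) B) \<le> g (insert (Suc n) B)" if "B \<subseteq> {1..n}" for B
    using that by (auto intro!: Suc.prems(1))
  ultimately have "bexp q n (\<lambda>B. (1 - q (Suc n)) * f B + q (Suc n) * f (insert (Suc n) B))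
      \<le> bexp q n (\<lambda>B. (1 - q (Suc n)) * g B + q (Suc n) * g (insert (Suc n) B))"
    using Suc.prems(2) by (intro Suc.IH) (auto intro!: add_mono mult_left_mono)
  then show ?case by simp
qed simp

lemma bexp_cong:
  assumes "\<And>B. B \<subseteq> {1..n} \<Longrightarrow> f B = g B"
  shows "bexp q n f = bexp q n g"
  using assms
proof (induction n arbitrary: f g)
  case (Suc n)
  have "f B = g B" "f (insert (Suc n) B) = g (insert (Suc n) B)" if "B \<subseteq> {1..n}" for B
    using that by (auto intro!: Suc.prems)
  then show ?case by (auto intro!: Suc.IH)
qed simp

lemma bexp_add: "bexp q n (\<lambda>B. f B + g B) = bexp q n f + bexp q n g"
proof (induction n arbitrary: f g)
  case (Suc n)
  have "(\<lambda>B. (1 - q (Suc n)) * (f B + g B) + q (Suc n) * (f (insert (Suc n) B) + g (insert (Suc n) B)))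
    = (\<lambda>B. ((1 - q (Suc n)) * f B + q (Suc n) * f (insert (Suc n) B))
         + ((1 - q (Suc n)) * g B + q (Suc n) * g (insert (Suc n) B)))"
    by (auto simp: algebra_simps)
  then show ?case by (simp add: Suc.IH)
qed simp

lemma bexp_cmult: "bexp q n (\<lambda>B. c * f B) = c * bexp q n f"
proof (induction n arbitrary: f)
  case (Suc n)
  have "(\<lambda>B. (1 - q (Suc n)) * (c * f B) + q (Suc n) * (c * f (insert (Suc n) B)))
    = (\<lambda>B. c * ((1 - q (Suc n)) * f B + q (Suc n) * f (insert (Suc n) B)))"
    by (auto simp: algebra_simps)
  then show ?case by (simp add: Suc.IH)
qed simp

lemma bexp_const [simp]: "bexp q n (\<lambda>B. c) = c"
  by (induction n) (auto simp: algebra_simps)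

lemma bexp_diff: "bexp q n (\<lambda>B. f B - g B) = bexp q n f - bexp q n g"
  using bexp_add[of q n f "\<lambda>B. (-1) * g B"] bexp_cmult[of q n "-1" g] by simp

lemma bexp_sum: "bexp q n (\<lambda>B. \<Sum>a\<in>A. f a B) = (\<Sum>a\<in>A. bexp q n (f a))"
  by (induction A rule: infinite_finite_induct) (auto simp: bexp_add)

lemma bexp_superset:
  assumes "S \<subseteq> {1..n}"
  shows "bexp q n (\<lambda>B. of_bool (S \<subseteq> B)) = (\<Prod>x\<in>S. q x)"
  using assms
proof (induction n arbitrary: S)
  case (Suc n)
  let ?S = "S - {Suc n}"
  have S: "?S \<subseteq> {1..n}" using Suc.prems by (auto simp: le_Suc_eq)
  have fin: "finite S" using Suc.prems finite_subset by blast
  show ?case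
  proof (cases "Suc n \<in> S")
    case True
    have "bexp q (Suc n) (\<lambda>B. of_bool (S \<subseteq> B)) = bexp q n (\<lambda>B. q (Suc n) * of_bool (?S \<subseteq> B))"
      using True unfolding bexp.simps by (intro bexp_cong) (auto simp: subset_insert_iff)
    also have "\<dots> = (\<Prod>x\<in>S. q x)"
      using Suc.IH[OF S] True fin by (simp add: bexp_cmult prod.remove)
    finally show ?thesis .
  next
    case False
    then have "?S = S" by auto
    have "bexp q (Suc n) (\<lambda>B. of_bool (S \<subseteq> B)) = bexp q n (\<lambda>B. of_bool (S \<subseteq> B))"
      using False unfolding bexp.simps
      by (intro bexp_cong) (auto simp: subset_insert_iff algebra_simps)
    then show ?thesis using Suc.IH[OF S] \<open>?S = S\<close> by simp
  qed
qed simp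

lemma bexp_markov:
  assumes "\<And>i. i \<in> {1..n} \<Longrightarrow> 0 \<le> q i \<and> q i \<le> 1"
    and "0 < c" and "\<And>B. B \<subseteq> {1..n} \<Longrightarrow> 0 \<le> f B" and "\<And>B. B \<subseteq> {1..n} \<Longrightarrow> P B \<Longrightarrow> c \<le> f B"
  shows "bexp q n (\<lambda>B. of_bool (P B)) \<le> bexp q n f / c"
proof -
  have "bexp q n (\<lambda>B. of_bool (P B)) \<le> bexp q n (\<lambda>B. (1 / c) * f B)"
    using assms by (intro bexp_mono) (auto simp: of_bool_def field_simps)
  then show ?thesis by (simp only: bexp_cmult) simp
qed

section \<open>The random subset of the statement as independent inclusion\<close>

lemma random_subset_Suc:
  assumes "0 \<le> p" "p \<le> 1"
  shows "random_subset (Suc n) p = bernoulli_pmf p \<bind> (\<lambda>b. map_pmf (\<lambda>B. if b then insert (Suc n) B else B) (random_subset n p))"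
proof -
  have *: "{1..Suc n} = insert (Suc n) {1..n}" by auto
  have "random_subset (Suc n) p = map_pmf (\<lambda>f. {x\<in>{1..Suc n}. f x})
     (map_pmf (\<lambda>(b, f). f(Suc n := b)) (pair_pmf (bernoulli_pmf p) (Pi_pmf {1..n} False (\<lambda>_. bernoulli_pmf p))))"
    unfolding random_subset_def * by (subst Pi_pmf_insert) auto
  also have "\<dots> = bernoulli_pmf p \<bind> (\<lambda>b. map_pmf (\<lambda>f. {x\<in>{1..Suc n}. (f(Suc n := b)) x}) (Pi_pmf {1..n} False (\<lambda>_. bernoulli_pmf p)))"
    by (simp add: pair_pmf_def map_pmf_def bind_assoc_pmf bind_return_pmf)
  also have "\<dots> = bernoulli_pmf p \<bind> (\<lambda>b. map_pmf (\<lambda>B. if b then insert (Suc n) B else B) (random_subset n p))"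
    unfolding random_subset_def pmf.map_comp
    by (intro bind_pmf_cong map_pmf_cong refl) auto
  finally show ?thesis .
qed

text \<open>This is the bridge from the \<open>pmf\<close> of the statement to \<open>bexp\<close>.
  The induction runs over expectations of arbitrary real functions, because averaging out the last
  vertex changes the integrand; finite support makes all of them integrable.\<close>

lemma prob_random_subset:
  assumes "0 \<le> p" "p \<le> 1"
  shows "measure_pmf.prob (random_subset n p) {B. P B} = bexp (\<lambda>_. p) n (\<lambda>B. of_bool (P B))"
proof -
  have fin: "finite (set_pmf (random_subset n p))" for n
    by (rule finite_subset[of _ "Pow {1..n}"]) (auto simp: random_subset_def)
  have "measure_pmf.expectation (random_subset n p) f = bexp (\<lambda>_. p) n f" for f :: "nat set \<Rightarrow> real"
  proof (induction n arbitrary: f)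
    case 0
    then show ?case by (simp add: random_subset_def)
  next
    case (Suc n)
    have "measure_pmf.expectation (random_subset (Suc n) p) f
      = (\<Sum>b\<in>UNIV. pmf (bernoulli_pmf p) b *\<^sub>R
           measure_pmf.expectation (map_pmf (\<lambda>B. if b then insert (Suc n) B else B) (random_subset n p)) f)"
      unfolding random_subset_Suc[OF assms] by (subst pmf_expectation_bind[where A = UNIV]) (auto simp: fin)
    also have "\<dots> = p * measure_pmf.expectation (random_subset n p) (\<lambda>B. f (insert (Suc n) B))
        + (1 - p) * measure_pmf.expectation (random_subset n p) f"
      using assms by (simp add: UNIV_bool)
    also have "\<dots> = measure_pmf.expectation (random_subset n p) (\<lambda>B. p * f (insert (Suc n) B) + (1 - p) * f B)"
      by (simp add: integrable_measure_pmf_finite[OF fin])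
    also have "\<dots> = bexp (\<lambda>_. p) n (\<lambda>B. p * f (insert (Suc n) B) + (1 - p) * f B)"
      by (rule Suc.IH)
    finally show ?case by (simp add: add.commute)
  qed
  from this[of "\<lambda>B. of_bool (P B)"]
  have "measure_pmf.expectation (random_subset n p) (\<lambda>B. of_bool (P B)) = bexp (\<lambda>_. p) n (\<lambda>B. of_bool (P B))"
    by auto
  moreover have "measure_pmf.expectation (random_subset n p) (indicator {B. P B}) = measure_pmf.prob (random_subset n p) {B. P B}"
    by simp
  moreover have "indicator {B. P B} = (\<lambda>B. of_bool (P B) :: real)" by (auto simp: indicator_def)
  ultimately show ?thesis by metis
qed

section \<open>Hypergraphs of bounded codegree\<close>

text \<open>The codegree bound is required for each \<open>R\<close> separately, so it is vacuous
  when \<open>N < r\<close>, where \<open>max_degree\<close> is a \<open>Max\<close> over the empty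
  set.\<close>

locale codegree_bounded =
  fixes H :: weighted_hypergraph and k r N :: nat and C :: real
  assumes uniform: "uniform_on k N H" and r_le_k: "r \<le> k" and C_nonneg: "0 \<le> C" and N_pos: "0 < N"
    and codegree: "\<And>R. R \<subseteq> {1..N} \<Longrightarrow> card R = r \<Longrightarrow> set_degree H R \<le> C"
begin

lemma edge_subset: "e \<in> edges H \<Longrightarrow> e \<subseteq> {1..N}"
  and card_edge: "e \<in> edges H \<Longrightarrow> card e = k"
  and weight_nonneg: "e \<in> edges H \<Longrightarrow> 0 \<le> weight H e"
  using uniform by (auto simp: uniform_on_def less_imp_le)

lemma finite_edge: "e \<in> edges H \<Longrightarrow> finite e"
  using edge_subset finite_subset by blast

lemma finite_edges [simp]: "finite (edges H)"
  by (rule finite_subset[of _ "Pow {1..N}"]) (use edge_subset in auto)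

lemma set_degree_eq: "set_degree H R = (\<Sum>e\<in>edges H. weight H e * of_bool (R \<subseteq> e))"
  unfolding set_degree_def by (subst sum.inter_filter) (simp_all add: of_bool_def if_distrib cong: if_cong)

lemma set_degree_nonneg: "0 \<le> set_degree H R"
  unfolding set_degree_def by (intro sum_nonneg weight_nonneg) auto

text \<open>Induction on \<open>r - card R\<close>: if \<open>card R < r \<le> k\<close>, every edge
  containing \<open>R\<close> has a further vertex, so the degree of \<open>R\<close> is at most the
  sum of the degrees of its at most \<open>N\<close> one-point extensions.\<close>

lemma set_degree_le:
  assumes "R \<subseteq> {1..N}" "card R \<le> r"
  shows "set_degree H R \<le> C * real N ^ (r - card R)"
  using assms
proof (induction "r - card R" arbitrary: R)
  case 0
  then show ?case using codegree[of R] by simp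
next
  case (Suc d)
  have finR: "finite R" using Suc.prems finite_subset by blast
  have card: "card R < r" using Suc.hyps(2) by linarith
  have "set_degree H R \<le> (\<Sum>e\<in>edges H. \<Sum>x\<in>{1..N} - R. weight H e * of_bool (insert x R \<subseteq> e))"
    unfolding set_degree_eq
  proof (rule sum_mono)
    fix e assume e: "e \<in> edges H"
    show "weight H e * of_bool (R \<subseteq> e) \<le> (\<Sum>x\<in>{1..N} - R. weight H e * of_bool (insert x R \<subseteq> e))"
    proof (cases "R \<subseteq> e")
      case True
      have "R \<noteq> e" using card card_edge[OF e] r_le_k by auto
      then obtain x where x: "x \<in> e" "x \<notin> R" using True by auto
      then have "x \<in> {1..N} - R" using edge_subset[OF e] by auto
      then have "weight H e * of_bool (insert x R \<subseteq> e) \<le> (\<Sum>x\<in>{1..N} - R. weight H e * of_bool (insert x R \<subseteq> e))"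
        by (intro member_le_sum) (auto simp: weight_nonneg e)
      then show ?thesis using True x by simp
    qed (simp add: sum_nonneg weight_nonneg e)
  qed
  also have "\<dots> = (\<Sum>x\<in>{1..N} - R. set_degree H (insert x R))"
    unfolding set_degree_eq by (rule sum.swap)
  also have "\<dots> \<le> (\<Sum>x\<in>{1..N} - R. C * real N ^ d)"
  proof (rule sum_mono)
    fix x assume x: "x \<in> {1..N} - R"
    then have c: "card (insert x R) = Suc (card R)" using finR by simp
    then have "d = r - card (insert x R)" using Suc.hyps(2) by simp
    moreover have "insert x R \<subseteq> {1..N}" "card (insert x R) \<le> r" using x Suc.prems card c by auto
    ultimately show "set_degree H (insert x R) \<le> C * real N ^ d"
      using Suc.hyps(1)[of "insert x R"] by simp
  qed
  also have "\<dots> \<le> real N * (C * real N ^ d)"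
  proof -
    have "card ({1..N} - R) \<le> N" using card_mono[of "{1..N}" "{1..N} - R"] by auto
    then show ?thesis using C_nonneg by (auto intro!: mult_right_mono)
  qed
  also have "\<dots> = C * real N ^ (r - card R)" using Suc.hyps(2)[symmetric] by simp
  finally show ?case .
qed

text \<open>The edges through \<open>I\<close> that meet \<open>U\<close> elsewhere contribute little to the expected number of
  edges through \<open>I\<close> once \<open>U\<close> is known to be in the random set. Classify them by the subset of \<open>U\<close>
  they contain, truncated at \<open>r - card I\<close> elements.\<close>

lemma colliding_weight_le:
  fixes p :: real
  assumes I: "I \<subseteq> {1..N}" "card I \<le> r" and U: "U \<subseteq> {1..N}" "card U \<le> u"
    and p: "0 < p" "p \<le> 1" and u: "real u \<le> p * real N"
  shows "(\<Sum>e | e \<in> edges H \<and> I \<subseteq> e \<and> (e - I) \<inter> U \<noteq> {}. weight H e * p ^ card (e - I - U))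
    \<le> C * real N ^ (r - card I) * p ^ (k - card I) *
       (real k * (u / (p * N)) + (u / N) ^ (r - card I) / p ^ (k - card I))"
proof -
  define r' where "r' = r - card I"
  define k' where "k' = k - card I"
  define sub where "sub i = {S. S \<subseteq> U - I \<and> card S = i}" for i
  define x where "x = u / (p * N)"
  have rk: "r' \<le> k'" "r' \<le> k" using r_le_k by (auto simp: r'_def k'_def)
  have finU: "finite U" and finI: "finite I" using U I finite_subset by blast+
  have fin_sub [simp]: "finite (sub i)" for i
    by (rule finite_subset[of _ "Pow U"]) (use finU in \<open>auto simp: sub_def\<close>)
  have x: "0 \<le> x" "x \<le> 1" using u p N_pos by (auto simp: x_def field_simps)
  \<comment> \<open>An edge with fewer than \<open>r'\<close> vertices in \<open>U - I\<close> is
    charged to exactly that set of vertices; any other edge contains some \<open>r'\<close>-subset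
    of \<open>U - I\<close>, and its power of \<open>p\<close> is bounded by 1.\<close>
  have "(\<Sum>e | e \<in> edges H \<and> I \<subseteq> e \<and> (e - I) \<inter> U \<noteq> {}. weight H e * p ^ card (e - I - U))
     \<le> (\<Sum>e | e \<in> edges H \<and> I \<subseteq> e \<and> (e - I) \<inter> U \<noteq> {}. weight H e *
         ((\<Sum>i\<in>{1..<r'}. p ^ (k' - i) * (\<Sum>S\<in>sub i. of_bool (S \<subseteq> e))) + (\<Sum>S\<in>sub r'. of_bool (S \<subseteq> e))))"
  proof (intro sum_mono mult_left_mono)
    fix e assume "e \<in> {e. e \<in> edges H \<and> I \<subseteq> e \<and> (e - I) \<inter> U \<noteq> {}}"
    then have e: "e \<in> edges H" "I \<subseteq> e" "(e - I) \<inter> U \<noteq> {}" by auto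
    let ?T = "(e - I) \<inter> U"
    have finT: "finite ?T" using finU by auto
    have cT: "1 \<le> card ?T" using e finT by (simp add: Suc_le_eq card_gt_0_iff)
    have "card (e - I) = k'"
      using card_Diff_subset[OF finI e(2)] card_edge[OF e(1)] by (simp add: k'_def)
    then have ce: "card (e - I - U) = k' - card ?T"
      using card_Diff_subset_Int[of "e - I" U] finT by simp
    have one: "1 \<le> (\<Sum>S\<in>sub i. of_bool (S \<subseteq> e) :: real)" if i: "i \<le> card ?T" for i
    proof -
      obtain S where S: "S \<subseteq> ?T" "card S = i"
        using obtain_subset_with_card_n[OF i] by metis
      then have S': "S \<in> sub i" by (auto simp: sub_def)
      have "(1 :: real) = of_bool (S \<subseteq> e)" using S by auto
      also have "\<dots> \<le> (\<Sum>S\<in>sub i. of_bool (S \<subseteq> e))"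
        by (intro member_le_sum S') auto
      finally show ?thesis .
    qed
    show "p ^ card (e - I - U) \<le> (\<Sum>i\<in>{1..<r'}. p ^ (k' - i) * (\<Sum>S\<in>sub i. of_bool (S \<subseteq> e))) + (\<Sum>S\<in>sub r'. of_bool (S \<subseteq> e))"
    proof (cases "card ?T < r'")
      case True
      have "p ^ card (e - I - U) \<le> p ^ (k' - card ?T) * (\<Sum>S\<in>sub (card ?T). of_bool (S \<subseteq> e))"
        unfolding ce using one[of "card ?T"] p by simp
      also have "\<dots> \<le> (\<Sum>i\<in>{1..<r'}. p ^ (k' - i) * (\<Sum>S\<in>sub i. of_bool (S \<subseteq> e)))"
        using True cT p by (intro member_le_sum[of _ _ "\<lambda>i. p ^ (k' - i) * (\<Sum>S\<in>sub i. of_bool (S \<subseteq> e))"])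
          (simp_all add: sum_nonneg)
      also have "\<dots> \<le> \<dots> + (\<Sum>S\<in>sub r'. of_bool (S \<subseteq> e))" by (simp add: sum_nonneg)
      finally show ?thesis .
    next
      case False
      have "p ^ card (e - I - U) \<le> (\<Sum>S\<in>sub r'. of_bool (S \<subseteq> e))"
        using one[of r'] False power_le_one[of p "card (e - I - U)"] p by linarith
      also have "\<dots> \<le> (\<Sum>i\<in>{1..<r'}. p ^ (k' - i) * (\<Sum>S\<in>sub i. of_bool (S \<subseteq> e))) + \<dots>"
        using p by (simp add: sum_nonneg)
      finally show ?thesis .
    qed
  qed (use weight_nonneg in auto)
  also have "\<dots> \<le> (\<Sum>e\<in>edges H. weight H e * of_bool (I \<subseteq> e) *
         ((\<Sum>i\<in>{1..<r'}. p ^ (k' - i) * (\<Sum>S\<in>sub i. of_bool (S \<subseteq> e))) + (\<Sum>S\<in>sub r'. of_bool (S \<subseteq> e))))"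
  proof -
    have "(\<Sum>e | e \<in> edges H \<and> I \<subseteq> e \<and> (e - I) \<inter> U \<noteq> {}. weight H e *
         ((\<Sum>i\<in>{1..<r'}. p ^ (k' - i) * (\<Sum>S\<in>sub i. of_bool (S \<subseteq> e))) + (\<Sum>S\<in>sub r'. of_bool (S \<subseteq> e))))
     = (\<Sum>e | e \<in> edges H \<and> I \<subseteq> e \<and> (e - I) \<inter> U \<noteq> {}. weight H e * of_bool (I \<subseteq> e) *
         ((\<Sum>i\<in>{1..<r'}. p ^ (k' - i) * (\<Sum>S\<in>sub i. of_bool (S \<subseteq> e))) + (\<Sum>S\<in>sub r'. of_bool (S \<subseteq> e))))"
      by (intro sum.cong) auto
    also have "\<dots> \<le> (\<Sum>e\<in>edges H. weight H e * of_bool (I \<subseteq> e) *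
         ((\<Sum>i\<in>{1..<r'}. p ^ (k' - i) * (\<Sum>S\<in>sub i. of_bool (S \<subseteq> e))) + (\<Sum>S\<in>sub r'. of_bool (S \<subseteq> e))))"
      using p by (intro sum_mono2) (auto intro!: mult_nonneg_nonneg add_nonneg_nonneg sum_nonneg weight_nonneg)
    finally show ?thesis .
  qed
  \<comment> \<open>Exchanging the sums, the edges through \<open>I\<close> that contain
    \<open>S\<close> are collected in the codegree of \<open>I \<union> S\<close>.\<close>
  also have "\<dots> = (\<Sum>i\<in>{1..<r'}. p ^ (k' - i) * (\<Sum>S\<in>sub i. set_degree H (I \<union> S))) + (\<Sum>S\<in>sub r'. set_degree H (I \<union> S))"
  proof -
    have swap: "(\<Sum>S\<in>sub i. set_degree H (I \<union> S)) = (\<Sum>e\<in>edges H. weight H e * of_bool (I \<subseteq> e) * (\<Sum>S\<in>sub i. of_bool (S \<subseteq> e)))" for i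
      unfolding set_degree_eq by (subst sum.swap) (auto simp: sum_distrib_left intro!: sum.cong)
    have distrib: "(\<Sum>e\<in>E. a e * ((\<Sum>i\<in>J. c i * T i e) + T r' e))
        = (\<Sum>i\<in>J. c i * (\<Sum>e\<in>E. a e * T i e)) + (\<Sum>e\<in>E. a e * T r' e)"
      for E :: "nat set set" and J :: "nat set" and a :: "nat set \<Rightarrow> real" and c T
    proof -
      have "(\<Sum>i\<in>J. c i * (\<Sum>e\<in>E. a e * T i e)) = (\<Sum>i\<in>J. \<Sum>e\<in>E. a e * (c i * T i e))"
        by (simp add: sum_distrib_left mult.left_commute)
      also have "\<dots> = (\<Sum>e\<in>E. a e * (\<Sum>i\<in>J. c i * T i e))"
        by (subst sum.swap) (simp add: sum_distrib_left)
      finally show ?thesis by (simp add: distrib_left sum.distrib)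
    qed
    show ?thesis unfolding swap by (rule distrib)
  qed
  also have "\<dots> \<le> (\<Sum>i\<in>{1..<r'}. p ^ (k' - i) * (real u ^ i * (C * real N ^ (r' - i)))) + real u ^ r' * C"
  proof -
    have bound: "(\<Sum>S\<in>sub i. set_degree H (I \<union> S)) \<le> real u ^ i * (C * real N ^ (r' - i))" if "i \<le> r'" for i
    proof -
      have "(\<Sum>S\<in>sub i. set_degree H (I \<union> S)) \<le> (\<Sum>S\<in>sub i. C * real N ^ (r' - i))"
      proof (rule sum_mono)
        fix S assume "S \<in> sub i"
        then have S: "S \<subseteq> U - I" "card S = i" by (auto simp: sub_def)
        then have "finite S" using finU finite_subset by blast
        then have "card (I \<union> S) = card I + i" using S finI by (subst card_Un_disjoint) auto
        moreover have "I \<union> S \<subseteq> {1..N}" using S I U by blast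
        ultimately show "set_degree H (I \<union> S) \<le> C * real N ^ (r' - i)"
          using set_degree_le[of "I \<union> S"] S I U that by (auto simp: r'_def)
      qed
      also have "\<dots> = real (card (sub i)) * (C * real N ^ (r' - i))" by simp
      also have "card (sub i) = card (U - I) choose i"
        unfolding sub_def using finU by (intro n_subsets) auto
      also have "real (card (U - I) choose i) \<le> real u ^ i"
      proof -
        have "card (U - I) \<le> u" using U finU card_mono[of U "U - I"] by auto
        have "card (U - I) choose i \<le> card (U - I) ^ i"
          by (cases "i \<le> card (U - I)") (simp_all add: binomial_le_pow binomial_eq_0)
        also have "\<dots> \<le> u ^ i" using \<open>card (U - I) \<le> u\<close> by (rule power_mono) simp
        finally have "card (U - I) choose i \<le> u ^ i" .
        then show ?thesis by (metis of_nat_le_iff of_nat_power)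
      qed
      finally show ?thesis using C_nonneg by (simp add: mult_right_mono)
    qed
    show ?thesis using p bound[of r'] by (intro add_mono sum_mono mult_left_mono bound) auto
  qed
  also have "\<dots> = C * real N ^ r' * p ^ k' * ((\<Sum>i\<in>{1..<r'}. x ^ i) + (u / N) ^ r' / p ^ k')"
  proof -
    have "p ^ (k' - i) * (real u ^ i * (C * real N ^ (r' - i))) = C * real N ^ r' * p ^ k' * x ^ i" if "i \<in> {1..<r'}" for i
    proof -
      have "i \<le> r'" "i \<le> k'" using that rk by auto
      then have "p ^ k' = p ^ (k' - i) * p ^ i" "real N ^ r' = real N ^ (r' - i) * real N ^ i"
        by (simp_all flip: power_add)
      then show ?thesis using p N_pos by (simp add: x_def power_divide power_mult_distrib)
    qed
    then have "(\<Sum>i\<in>{1..<r'}. p ^ (k' - i) * (real u ^ i * (C * real N ^ (r' - i)))) = C * real N ^ r' * p ^ k' * (\<Sum>i\<in>{1..<r'}. x ^ i)"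
      unfolding sum_distrib_left by (intro sum.cong refl)
    then show ?thesis using p N_pos by (simp add: distrib_left power_divide)
  qed
  also have "\<dots> \<le> C * real N ^ r' * p ^ k' * (real k * x + (u / N) ^ r' / p ^ k')"
  proof -
    \<comment> \<open>Since \<open>x \<le> 1\<close> and exponents start at 1, each of the at most
      \<open>k\<close> powers is at most \<open>x\<close>.\<close>
    have "(\<Sum>i\<in>{1..<r'}. x ^ i) \<le> (\<Sum>i\<in>{1..<r'}. x)"
      using x power_decreasing[of 1 _ x] by (intro sum_mono) auto
    also have "\<dots> \<le> real k * x" using x rk by (auto intro!: mult_right_mono)
    finally show ?thesis using C_nonneg p by (intro mult_left_mono add_mono) auto
  qed
  finally show ?thesis unfolding x_def r'_def k'_def .
qed

end

section \<open>Moments and the martingale bound\<close>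

text \<open>Expand the power one factor at a time: choosing \<open>e\<close> in one factor forces
  \<open>T e\<close> into \<open>B\<close>, so the occupied set grows from \<open>U\<close> to
  \<open>U \<union> T e\<close>, by at most \<open>m\<close> elements, and stays within the size
  \<open>u\<close> up to which \<open>bound\<close> applies. The indicator of
  \<open>U \<subseteq> B\<close> carries the occupied set through the induction.\<close>

lemma bexp_power_le:
  fixes v :: "'a \<Rightarrow> real" and T :: "'a \<Rightarrow> nat set" and p \<beta> :: real
  assumes v: "\<And>e. e \<in> F \<Longrightarrow> 0 \<le> v e" and T: "\<And>e. e \<in> F \<Longrightarrow> T e \<subseteq> {1..n} \<and> card (T e) \<le> m"
    and p: "0 \<le> p" "p \<le> 1" and \<beta>: "0 \<le> \<beta>"
    and bound: "\<And>U. U \<subseteq> {1..n} \<Longrightarrow> card U \<le> u \<Longrightarrow> (\<Sum>e\<in>F. v e * p ^ card (T e - U)) \<le> \<beta>"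
    and U: "U \<subseteq> {1..n}" "card U + m * M \<le> u"
  shows "bexp (\<lambda>_. p) n (\<lambda>B. of_bool (U \<subseteq> B) * (\<Sum>e\<in>F. v e * of_bool (T e \<subseteq> B)) ^ M) \<le> p ^ card U * \<beta> ^ M"
  using U
proof (induction M arbitrary: U)
  case 0
  then show ?case by (simp add: bexp_superset)
next
  case (Suc M)
  define Y where "Y B = (\<Sum>e\<in>F. v e * of_bool (T e \<subseteq> B))" for B
  have finU: "finite U" using Suc.prems finite_subset by blast
  have expand: "of_bool (U \<subseteq> B) * Y B ^ Suc M = (\<Sum>e\<in>F. v e * (of_bool (U \<union> T e \<subseteq> B) * Y B ^ M))" for B
  proof -
    have "of_bool (U \<subseteq> B) * Y B ^ Suc M = of_bool (U \<subseteq> B) * Y B ^ M * Y B" by simp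
    also have "\<dots> = (\<Sum>e\<in>F. of_bool (U \<subseteq> B) * Y B ^ M * (v e * of_bool (T e \<subseteq> B)))"
      by (simp only: Y_def[of B] sum_distrib_left)
    also have "\<dots> = (\<Sum>e\<in>F. v e * (of_bool (U \<union> T e \<subseteq> B) * Y B ^ M))"
      by (intro sum.cong refl) auto
    finally show ?thesis .
  qed
  have "bexp (\<lambda>_. p) n (\<lambda>B. of_bool (U \<subseteq> B) * Y B ^ Suc M)
     = (\<Sum>e\<in>F. v e * bexp (\<lambda>_. p) n (\<lambda>B. of_bool (U \<union> T e \<subseteq> B) * Y B ^ M))"
    unfolding expand by (simp add: bexp_sum bexp_cmult)
  also have "\<dots> \<le> (\<Sum>e\<in>F. v e * (p ^ card (U \<union> T e) * \<beta> ^ M))"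
  proof (intro sum_mono mult_left_mono v)
    fix e assume e: "e \<in> F"
    have "card (U \<union> T e) \<le> card U + m" using card_Un_le[of U "T e"] T[OF e] by linarith
    then show "bexp (\<lambda>_. p) n (\<lambda>B. of_bool (U \<union> T e \<subseteq> B) * Y B ^ M) \<le> p ^ card (U \<union> T e) * \<beta> ^ M"
      using Suc.prems T[OF e] unfolding Y_def by (intro Suc.IH) auto
  qed
  also have "\<dots> = (\<Sum>e\<in>F. v e * p ^ card (T e - U)) * (p ^ card U * \<beta> ^ M)"
  proof -
    have "p ^ card (U \<union> T e) = p ^ card U * p ^ card (T e - U)" if "e \<in> F" for e
    proof -
      have "card (U \<union> T e) = card U + card (T e - U)"
        using finU finite_subset[of "T e" "{1..n}"] T[OF that]
        by (metis card_Un_disjoint Diff_disjoint Un_Diff_cancel finite_Diff finite_atLeastAtMost)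
      then show ?thesis by (simp add: power_add)
    qed
    then show ?thesis by (simp add: sum_distrib_right sum_distrib_left mult_ac)
  qed
  also have "\<dots> \<le> \<beta> * (p ^ card U * \<beta> ^ M)"
    using p \<beta> Suc.prems by (intro mult_right_mono bound) auto
  finally show ?case by (simp add: Y_def mult_ac)
qed

section \<open>Exponential moments of bounded martingale differences\<close>

lemma exp_le_quadratic:
  fixes y :: real
  assumes "\<bar>y\<bar> \<le> \<kappa>"
  shows "exp y \<le> 1 + y + y\<^sup>2 / 2 * exp \<kappa>"
proof -
  obtain t where t: "\<bar>t\<bar> \<le> \<bar>y\<bar>" "exp y = (\<Sum>m<2. y ^ m / fact m) + exp t / fact 2 * y ^ 2"
    using Maclaurin_exp_le[of y 2] by blast
  have "exp t * y\<^sup>2 \<le> exp \<kappa> * y\<^sup>2" using t assms by (intro mult_right_mono) auto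
  then show ?thesis using t by (simp add: numeral_2_eq_2 mult.commute)
qed

text \<open>The linear terms cancel because the variable is centred, and its second moment is
  \<open>p * (1 - p) * z\<^sup>2\<close>; the factor \<open>exp \<kappa>\<close> is the price of the
  quadratic expansion.\<close>

lemma bernoulli_exp_le:
  fixes p \<theta> z \<kappa> :: real
  assumes p: "0 \<le> p" "p \<le> 1" and z: "\<bar>\<theta> * z\<bar> \<le> \<kappa>"
  shows "(1 - p) * exp (\<theta> * ((0 - p) * z)) + p * exp (\<theta> * ((1 - p) * z))
    \<le> exp (\<theta>\<^sup>2 * p * (1 - p) / 2 * exp \<kappa> * z\<^sup>2)"
proof -
  have "\<bar>a * (\<theta> * z)\<bar> \<le> \<kappa>" if "\<bar>a\<bar> \<le> 1" for a
  proof -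
    have "\<bar>a * (\<theta> * z)\<bar> \<le> 1 * \<kappa>" unfolding abs_mult[of a] using that z by (intro mult_mono) auto
    then show ?thesis by simp
  qed
  from this[of "- p"] this[of "1 - p"]
  have *: "exp (\<theta> * ((0 - p) * z)) \<le> 1 + \<theta> * ((0 - p) * z) + (\<theta> * ((0 - p) * z))\<^sup>2 / 2 * exp \<kappa>"
    "exp (\<theta> * ((1 - p) * z)) \<le> 1 + \<theta> * ((1 - p) * z) + (\<theta> * ((1 - p) * z))\<^sup>2 / 2 * exp \<kappa>"
    using p by (intro exp_le_quadratic; simp add: mult_ac)+
  have "(1 - p) * exp (\<theta> * ((0 - p) * z)) + p * exp (\<theta> * ((1 - p) * z))
    \<le> (1 - p) * (1 + \<theta> * ((0 - p) * z) + (\<theta> * ((0 - p) * z))\<^sup>2 / 2 * exp \<kappa>)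
      + p * (1 + \<theta> * ((1 - p) * z) + (\<theta> * ((1 - p) * z))\<^sup>2 / 2 * exp \<kappa>)"
    using p by (intro add_mono mult_left_mono *) auto
  also have "\<dots> = 1 + \<theta>\<^sup>2 * p * (1 - p) / 2 * exp \<kappa> * z\<^sup>2"
    by (simp add: power2_eq_square field_simps)
  also have "\<dots> \<le> exp (\<theta>\<^sup>2 * p * (1 - p) / 2 * exp \<kappa> * z\<^sup>2)" by (rule exp_ge_add_one_self)
  finally show ?thesis .
qed

text \<open>The summand \<open>(of_bool (i \<in> B) - p) * Z i B\<close> is a martingale difference, as \<open>Z i\<close> depends
  only on \<open>B \<inter> {..<i}\<close>.\<close>

lemma bexp_exp_martingale_le:
  fixes p \<theta> \<kappa> :: real and Z :: "nat \<Rightarrow> nat set \<Rightarrow> real" and b :: "nat \<Rightarrow> real"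
  assumes p: "0 \<le> p" "p \<le> 1" and predictable: "\<And>i j B. i \<le> j \<Longrightarrow> Z i (insert j B) = Z i B"
    and Z: "\<And>i B. 0 \<le> Z i B \<and> Z i B \<le> b i" and \<kappa>: "\<And>i. i \<in> {1..n} \<Longrightarrow> \<bar>\<theta>\<bar> * b i \<le> \<kappa>"
  shows "bexp (\<lambda>_. p) n (\<lambda>B. exp (\<theta> * (\<Sum>i=1..n. (of_bool (i \<in> B) - p) * Z i B)))
    \<le> exp (\<theta>\<^sup>2 * p * (1 - p) / 2 * exp \<kappa> * (\<Sum>i=1..n. (b i)\<^sup>2))"
  using \<kappa>
proof (induction n)
  case (Suc n)
  define S where "S B = (\<Sum>i=1..n. (of_bool (i \<in> B) - p) * Z i B)" for B
  define v where "v = \<theta>\<^sup>2 * p * (1 - p) / 2 * exp \<kappa>"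
  have "0 \<le> v" using p by (auto simp: v_def)
  \<comment> \<open>Neither the earlier indicators nor the earlier \<open>Z i\<close> see the vertex
    \<open>Suc n\<close>, so only the last summand is averaged.\<close>
  have S_insert: "S (insert (Suc n) B) = S B" for B
    unfolding S_def by (intro sum.cong) (auto simp: predictable)
  have "bexp (\<lambda>_. p) (Suc n) (\<lambda>B. exp (\<theta> * (\<Sum>i=1..Suc n. (of_bool (i \<in> B) - p) * Z i B)))
    = bexp (\<lambda>_. p) n (\<lambda>B. exp (\<theta> * S B) * ((1 - p) * exp (\<theta> * ((0 - p) * Z (Suc n) B)) + p * exp (\<theta> * ((1 - p) * Z (Suc n) B))))"
    unfolding bexp.simps
  proof (intro bexp_cong)
    fix B assume "B \<subseteq> {1..n}"
    then have "Suc n \<notin> B" by auto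
    then have "(\<Sum>i=1..Suc n. (of_bool (i \<in> B) - p) * Z i B) = S B + (0 - p) * Z (Suc n) B"
      "(\<Sum>i=1..Suc n. (of_bool (i \<in> insert (Suc n) B) - p) * Z i (insert (Suc n) B)) = S B + (1 - p) * Z (Suc n) B"
      using S_insert[of B] by (simp_all add: S_def predictable)
    then show "(1 - p) * exp (\<theta> * (\<Sum>i = 1..Suc n. (of_bool (i \<in> B) - p) * Z i B)) +
        p * exp (\<theta> * (\<Sum>i = 1..Suc n. (of_bool (i \<in> insert (Suc n) B) - p) * Z i (insert (Suc n) B)))
       = exp (\<theta> * S B) * ((1 - p) * exp (\<theta> * ((0 - p) * Z (Suc n) B)) + p * exp (\<theta> * ((1 - p) * Z (Suc n) B)))"
      by (simp only: distrib_left[of \<theta>] exp_add) (simp only: algebra_simps)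
  qed
  also have "\<dots> \<le> bexp (\<lambda>_. p) n (\<lambda>B. exp (v * (b (Suc n))\<^sup>2) * exp (\<theta> * S B))"
  proof (intro bexp_mono)
    fix B
    have "\<bar>\<theta> * Z (Suc n) B\<bar> \<le> \<bar>\<theta>\<bar> * b (Suc n)"
      unfolding abs_mult using Z[of "Suc n" B] by (intro mult_left_mono) auto
    also have "\<dots> \<le> \<kappa>" using Suc.prems by simp
    finally have "(1 - p) * exp (\<theta> * ((0 - p) * Z (Suc n) B)) + p * exp (\<theta> * ((1 - p) * Z (Suc n) B))
        \<le> exp (v * (Z (Suc n) B)\<^sup>2)"
      unfolding v_def by (rule bernoulli_exp_le[OF p])
    also have "\<dots> \<le> exp (v * (b (Suc n))\<^sup>2)"
      using Z[of "Suc n" B] \<open>0 \<le> v\<close> by (simp add: mult_left_mono power_mono)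
    finally show "exp (\<theta> * S B) * ((1 - p) * exp (\<theta> * ((0 - p) * Z (Suc n) B)) + p * exp (\<theta> * ((1 - p) * Z (Suc n) B)))
      \<le> exp (v * (b (Suc n))\<^sup>2) * exp (\<theta> * S B)"
      by (simp add: mult.commute mult_left_mono)
  qed (use p in auto)
  also have "\<dots> \<le> exp (v * (b (Suc n))\<^sup>2) * exp (v * (\<Sum>i=1..n. (b i)\<^sup>2))"
    unfolding bexp_cmult v_def S_def using Suc by (intro mult_left_mono) auto
  finally show ?case by (simp add: v_def distrib_left exp_add mult.commute)
qed simp

text \<open>Reveal the vertices in increasing order. The summands are the increments of the
  conditional probability of \<open>e \<subseteq> B\<close>; a vertex outside \<open>e\<close>
  contributes none.\<close>

lemma edge_telescope:
  fixes p :: real and N :: nat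
  assumes e: "e \<subseteq> {1..N}"
  shows "of_bool (e \<subseteq> B) - p ^ card e
    = (\<Sum>i=1..N. of_bool (i \<in> e) * ((of_bool (i \<in> B) - p) * (p ^ card {x\<in>e. i < x} * of_bool ({x\<in>e. x < i} \<subseteq> B))))"
    (is "_ = (\<Sum>i=1..N. ?t i)")
proof -
  have fin: "finite e" by (rule finite_subset[OF e]) simp
  \<comment> \<open>The probability of \<open>e \<subseteq> B\<close> given
    \<open>B \<inter> {1..j}\<close>; it runs from \<open>p ^ card e\<close> at 0 to the indicator
    at \<open>N\<close>.\<close>
  define a where "a j = p ^ card {x\<in>e. j < x} * of_bool ({x\<in>e. x \<le> j} \<subseteq> B)" for j
  have "a n - a 0 = (\<Sum>i=1..n. ?t i)" for n
  proof (induction n)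
    case (Suc n)
    have "a (Suc n) - a n = ?t (Suc n)"
    proof (cases "Suc n \<in> e")
      case True
      have s: "{x\<in>e. n < x} = insert (Suc n) {x\<in>e. Suc n < x}" "{x\<in>e. x \<le> Suc n} = insert (Suc n) {x\<in>e. x \<le> n}"
        "{x\<in>e. x < Suc n} = {x\<in>e. x \<le> n}"
        using True by auto
      have "card {x\<in>e. n < x} = Suc (card {x\<in>e. Suc n < x})" unfolding s using fin by simp
      then show ?thesis using True unfolding a_def s(2,3) by (auto simp: algebra_simps)
    next
      case False
      have s: "{x\<in>e. n < x} = {x\<in>e. Suc n < x}" "{x\<in>e. x \<le> Suc n} = {x\<in>e. x \<le> n}"
        using False by (auto simp: le_Suc_eq less_Suc_eq Suc_le_eq intro: Suc_lessI)
      then show ?thesis using False unfolding a_def s by simp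
    qed
    then show ?case using Suc by simp
  qed simp
  moreover have "{x\<in>e. N < x} = {}" "{x\<in>e. x \<le> N} = e" "{x\<in>e. 0 < x} = e" "{x\<in>e. x \<le> 0} = {}"
    using e by (auto simp: subset_iff)
  then have "a N = of_bool (e \<subseteq> B)" "a 0 = p ^ card e"
    by (simp_all only: a_def) simp_all
  ultimately show ?thesis by metis
qed

section \<open>The deviation as a vertex-exposure martingale\<close>

context codegree_bounded
begin

text \<open>\<open>p\<close> times this is the conditional expectation of the weight of the edges through \<open>i\<close> inside
  the random set, given its elements below \<open>i\<close>.\<close>

definition partial_degree :: "real \<Rightarrow> nat \<Rightarrow> nat set \<Rightarrow> real" where
  "partial_degree p i B =
     (\<Sum>e | e \<in> edges H \<and> i \<in> e. weight H e * p ^ card {x\<in>e. i < x} * of_bool ({x\<in>e. x < i} \<subseteq> B))"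

lemma partial_degree_nonneg: "0 \<le> p \<Longrightarrow> 0 \<le> partial_degree p i B"
  unfolding partial_degree_def by (intro sum_nonneg mult_nonneg_nonneg weight_nonneg) auto

lemma partial_degree_insert: "i \<le> j \<Longrightarrow> partial_degree p i (insert j B) = partial_degree p i B"
  unfolding partial_degree_def by (intro sum.cong refl) (auto simp: subset_iff)

lemma weight_inside_eq: "weight_inside H B = (\<Sum>e\<in>edges H. weight H e * of_bool (e \<subseteq> B))"
  unfolding weight_inside_def by (subst sum.inter_filter) (simp_all add: of_bool_def if_distrib cong: if_cong)

text \<open>Multiply \<open>edge_telescope\<close> by the weight of the edge, sum over the edges and
  collect the terms by exposed vertex.\<close>

lemma deviation_eq:
  "deviation k p H B = (\<Sum>i=1..N. (of_bool (i \<in> B) - p) * partial_degree p i B)"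
proof -
  have "deviation k p H B = (\<Sum>e\<in>edges H. weight H e * (of_bool (e \<subseteq> B) - p ^ card e))"
    unfolding deviation_def weight_inside_eq total_weight_def
    by (simp add: card_edge sum_distrib_left sum_subtractf right_diff_distrib mult.commute cong: sum.cong)
  also have "\<dots> = (\<Sum>e\<in>edges H. \<Sum>i=1..N. weight H e * (of_bool (i \<in> e) * ((of_bool (i \<in> B) - p) * (p ^ card {x\<in>e. i < x} * of_bool ({x\<in>e. x < i} \<subseteq> B)))))"
    by (intro sum.cong refl) (simp only: edge_telescope[OF edge_subset] sum_distrib_left)
  also have "\<dots> = (\<Sum>i=1..N. \<Sum>e\<in>edges H. weight H e * (of_bool (i \<in> e) * ((of_bool (i \<in> B) - p) * (p ^ card {x\<in>e. i < x} * of_bool ({x\<in>e. x < i} \<subseteq> B)))))"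
    by (rule sum.swap)
  also have "\<dots> = (\<Sum>i=1..N. (of_bool (i \<in> B) - p) * partial_degree p i B)"
    unfolding partial_degree_def sum.inter_filter[OF finite_edges] sum_distrib_left
    by (intro sum.cong refl) (auto simp: mult_ac)
  finally show ?thesis .
qed

text \<open>An instance of \<open>bexp_power_le\<close> in which each factor occupies at most
  \<open>k - 1\<close> vertices. Given an occupied set \<open>U\<close>, the edges through
  \<open>i\<close> that avoid it elsewhere contribute at most \<open>p ^ (k - 1)\<close> times the
  degree of \<open>i\<close>; \<open>colliding_weight_le\<close> with \<open>{i}\<close> controls
  the others.\<close>

lemma partial_degree_moment_le:
  fixes p :: real
  assumes i: "i \<in> {1..N}" and r: "1 \<le> r" and p: "0 < p" "p \<le> 1" and u: "real u \<le> p * N" "(k - 1) * M \<le> u"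
  shows "bexp (\<lambda>_. p) N (\<lambda>B. partial_degree p i B ^ M)
    \<le> (p ^ (k - 1) * (set_degree H {i} + C * real N ^ (r - 1) * (k * (u / (p * N)) + (u / N) ^ (r - 1) / p ^ (k - 1)))) ^ M"
    (is "_ \<le> ?\<beta> ^ M")
proof -
  let ?F = "{e. e \<in> edges H \<and> i \<in> e}"
  let ?z = "k * (u / (p * N)) + (u / N) ^ (r - 1) / p ^ (k - 1)"
  have bound: "(\<Sum>e\<in>?F. (weight H e * p ^ card {x\<in>e. i < x}) * p ^ card ({x\<in>e. x < i} - U)) \<le> ?\<beta>"
    if U: "U \<subseteq> {1..N}" "card U \<le> u" for U
  proof -
    let ?G = "{e. e \<in> edges H \<and> {i} \<subseteq> e \<and> (e - {i}) \<inter> U \<noteq> {}}"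
    have "(\<Sum>e\<in>?F. (weight H e * p ^ card {x\<in>e. i < x}) * p ^ card ({x\<in>e. x < i} - U))
        \<le> (\<Sum>e\<in>?F. weight H e * p ^ card (e - {i} - U))"
    proof (intro sum_mono)
      fix e assume "e \<in> ?F"
      then have e: "e \<in> edges H" "i \<in> e" by auto
      \<comment> \<open>Vertices above \<open>i\<close> keep their factor \<open>p\<close> even if
        they lie in \<open>U\<close>; dropping that factor only enlarges the bound.\<close>
      have "e - {i} - U \<subseteq> {x\<in>e. i < x} \<union> ({x\<in>e. x < i} - U)" by auto
      then have "card (e - {i} - U) \<le> card ({x\<in>e. i < x} \<union> ({x\<in>e. x < i} - U))"
        using finite_edge[OF e(1)] by (intro card_mono) auto
      also have "\<dots> \<le> card {x\<in>e. i < x} + card ({x\<in>e. x < i} - U)" by (rule card_Un_le)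
      finally have "p ^ (card {x\<in>e. i < x} + card ({x\<in>e. x < i} - U)) \<le> p ^ card (e - {i} - U)"
        using p by (intro power_decreasing) auto
      then show "(weight H e * p ^ card {x\<in>e. i < x}) * p ^ card ({x\<in>e. x < i} - U) \<le> weight H e * p ^ card (e - {i} - U)"
        using weight_nonneg[OF e(1)] by (simp add: power_add mult_left_mono mult.assoc)
    qed
    also have "\<dots> = (\<Sum>e\<in>?F - ?G. weight H e * p ^ card (e - {i} - U)) + (\<Sum>e\<in>?G. weight H e * p ^ card (e - {i} - U))"
      by (intro sum.subset_diff) auto
    also have "(\<Sum>e\<in>?F - ?G. weight H e * p ^ card (e - {i} - U)) = (\<Sum>e\<in>?F - ?G. weight H e * p ^ (k - 1))"
    proof (intro sum.cong refl)
      fix e assume e: "e \<in> ?F - ?G"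
      then have "e - {i} - U = e - {i}" by auto
      then show "weight H e * p ^ card (e - {i} - U) = weight H e * p ^ (k - 1)" using e card_edge by simp
    qed
    also have "\<dots> \<le> (\<Sum>e\<in>?F. weight H e * p ^ (k - 1))"
      using p by (intro sum_mono2) (auto simp: weight_nonneg)
    also have "\<dots> = p ^ (k - 1) * set_degree H {i}"
      by (simp add: set_degree_def sum_distrib_left mult.commute)
    also have "(\<Sum>e\<in>?G. weight H e * p ^ card (e - {i} - U)) \<le> C * real N ^ (r - 1) * p ^ (k - 1) * ?z"
      using colliding_weight_le[of "{i}" U u p] i r p u U by simp
    finally show ?thesis by (simp add: algebra_simps)
  qed
  have "bexp (\<lambda>_. p) N (\<lambda>B. of_bool ({} \<subseteq> B) * (\<Sum>e\<in>?F. (weight H e * p ^ card {x\<in>e. i < x}) * of_bool ({x\<in>e. x < i} \<subseteq> B)) ^ M)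
     \<le> p ^ card ({} :: nat set) * ?\<beta> ^ M"
  proof (rule bexp_power_le[where m = "k - 1" and u = u])
    fix e assume e: "e \<in> ?F"
    then have "card {x\<in>e. x < i} \<le> card (e - {i})" using finite_edge by (intro card_mono) auto
    then show "{x\<in>e. x < i} \<subseteq> {1..N} \<and> card {x\<in>e. x < i} \<le> k - 1"
      using e edge_subset card_edge by auto
  next
    show "0 \<le> ?\<beta>" using p C_nonneg set_degree_nonneg
      by (intro mult_nonneg_nonneg add_nonneg_nonneg) auto
  qed (use p u bound weight_nonneg in auto)
  then show ?thesis by (simp add: partial_degree_def)
qed

text \<open>Replace each partial degree by 0 where it exceeds \<open>b i\<close>; this keeps the
  summands predictable and bounded. Where nothing is replaced the sum is still the deviation, and
  exponential Markov with parameter \<open>\<sigma> * \<theta>\<close> applies; the other outcomes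
  are covered by a union bound and Markov's inequality for the \<open>M\<close>-th moment.\<close>

lemma deviation_tail_le:
  fixes p \<theta> t \<sigma> \<kappa> :: real and b \<beta> :: "nat \<Rightarrow> real"
  assumes \<sigma>: "\<bar>\<sigma>\<bar> = 1" and p: "0 < p" "p \<le> 1" and \<theta>: "0 \<le> \<theta>"
    and b: "\<And>i. 0 < b i" and \<kappa>: "\<And>i. i \<in> {1..N} \<Longrightarrow> \<theta> * b i \<le> \<kappa>"
    and moment: "\<And>i. i \<in> {1..N} \<Longrightarrow> bexp (\<lambda>_. p) N (\<lambda>B. partial_degree p i B ^ M) \<le> \<beta> i ^ M"
  shows "bexp (\<lambda>_. p) N (\<lambda>B. of_bool (t \<le> \<sigma> * deviation k p H B))
    \<le> exp (- \<theta> * t + \<theta>\<^sup>2 * p * (1 - p) / 2 * exp \<kappa> * (\<Sum>i=1..N. (b i)\<^sup>2)) + (\<Sum>i=1..N. (\<beta> i / b i) ^ M)"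
proof -
  define Z where "Z i B = partial_degree p i B * of_bool (partial_degree p i B \<le> b i)" for i B
  define S where "S B = (\<Sum>i=1..N. (of_bool (i \<in> B) - p) * Z i B)" for B
  have \<sigma>2: "\<sigma>\<^sup>2 = 1" using \<sigma> by (metis one_power2 power2_abs)
  have "bexp (\<lambda>_. p) N (\<lambda>B. of_bool (t \<le> \<sigma> * deviation k p H B))
    \<le> bexp (\<lambda>_. p) N (\<lambda>B. exp (- \<theta> * t) * exp ((\<sigma> * \<theta>) * S B) + (\<Sum>i=1..N. of_bool (b i < partial_degree p i B)))"
  proof (intro bexp_mono)
    fix B
    show "of_bool (t \<le> \<sigma> * deviation k p H B) \<le> exp (- \<theta> * t) * exp ((\<sigma> * \<theta>) * S B) + (\<Sum>i=1..N. of_bool (b i < partial_degree p i B))"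
    proof (cases "\<exists>i\<in>{1..N}. b i < partial_degree p i B")
      case True
      then obtain i where i: "i \<in> {1..N}" "b i < partial_degree p i B" by auto
      have "(1::real) = of_bool (b i < partial_degree p i B)" using i by simp
      also have "\<dots> \<le> (\<Sum>i=1..N. of_bool (b i < partial_degree p i B))" using i by (intro member_le_sum) auto
      finally show ?thesis by (smt (verit) exp_gt_zero mult_pos_pos of_bool_eq)
    next
      case False
      then have "S B = deviation k p H B"
        unfolding S_def deviation_eq Z_def by (intro sum.cong) (auto simp: not_less)
      moreover have "1 \<le> exp (- \<theta> * t) * exp ((\<sigma> * \<theta>) * deviation k p H B)" if "t \<le> \<sigma> * deviation k p H B"
        using mult_left_mono[OF that \<theta>] by (simp add: exp_add[symmetric] mult_ac)
      moreover have "0 \<le> (\<Sum>i=1..N. of_bool (b i < partial_degree p i B) :: real)" by (intro sum_nonneg) auto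
      ultimately show ?thesis by (auto simp del: sum_of_bool_eq intro: add_nonneg_nonneg)
    qed
  qed (use p in auto)
  also have "\<dots> = exp (- \<theta> * t) * bexp (\<lambda>_. p) N (\<lambda>B. exp ((\<sigma> * \<theta>) * S B))
      + (\<Sum>i=1..N. bexp (\<lambda>_. p) N (\<lambda>B. of_bool (b i < partial_degree p i B)))"
    by (simp only: bexp_add bexp_cmult bexp_sum)
  also have "\<dots> \<le> exp (- \<theta> * t) * exp ((\<sigma> * \<theta>)\<^sup>2 * p * (1 - p) / 2 * exp \<kappa> * (\<Sum>i=1..N. (b i)\<^sup>2)) + (\<Sum>i=1..N. (\<beta> i / b i) ^ M)"
  proof (intro add_mono mult_left_mono sum_mono)
    show "bexp (\<lambda>_. p) N (\<lambda>B. exp ((\<sigma> * \<theta>) * S B)) \<le> exp ((\<sigma> * \<theta>)\<^sup>2 * p * (1 - p) / 2 * exp \<kappa> * (\<Sum>i=1..N. (b i)\<^sup>2))"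
      unfolding S_def
    proof (rule bexp_exp_martingale_le)
      show "0 \<le> Z i B \<and> Z i B \<le> b i" for i B
        using b[of i] partial_degree_nonneg[of p i B] p by (auto simp: Z_def)
      show "\<bar>\<sigma> * \<theta>\<bar> * b i \<le> \<kappa>" if "i \<in> {1..N}" for i
        using \<kappa>[OF that] \<sigma> \<theta> by (simp add: abs_mult)
    qed (use p in \<open>auto simp: Z_def partial_degree_insert\<close>)
  next
    fix i assume i: "i \<in> {1..N}"
    have "bexp (\<lambda>_. p) N (\<lambda>B. of_bool (b i < partial_degree p i B)) \<le> bexp (\<lambda>_. p) N (\<lambda>B. partial_degree p i B ^ M) / b i ^ M"
      using p b[of i] by (intro bexp_markov) (auto simp: partial_degree_nonneg power_mono)
    also have "\<dots> \<le> (\<beta> i / b i) ^ M"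
      using moment[OF i] b[of i] by (simp add: power_divide divide_right_mono less_imp_le)
    finally show "bexp (\<lambda>_. p) N (\<lambda>B. of_bool (b i < partial_degree p i B)) \<le> (\<beta> i / b i) ^ M" .
  qed auto
  finally show ?thesis unfolding exp_add by (simp only: power_mult_distrib \<sigma>2 mult_1_left)
qed

end

section \<open>Tilted measures\<close>

text \<open>The relative entropy of a Bernoulli law of mean \<open>q\<close> with respect to one of
  mean \<open>p\<close>.\<close>

definition bernoulli_kl :: "real \<Rightarrow> real \<Rightarrow> real" where
  "bernoulli_kl q p = q * ln (q / p) + (1 - q) * ln ((1 - q) / (1 - p))"

text \<open>Jensen's inequality for \<open>exp\<close>, after subtracting from each value its
  log-likelihood ratio: this turns the average of the exponentials under \<open>q\<close> into the
  one under \<open>p\<close>, and the mean subtracted is the relative entropy.\<close>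

lemma exp_bernoulli_mean_le:
  fixes p q a b :: real
  assumes "0 < p" "p < 1" "0 < q" "q < 1"
  shows "exp ((1 - q) * a + q * b) \<le> exp (bernoulli_kl q p) * ((1 - p) * exp a + p * exp b)"
proof -
  let ?a = "a - ln ((1 - q) / (1 - p))" and ?b = "b - ln (q / p)"
  have "exp ((1 - q) * ?a + q * ?b) \<le> (1 - q) * exp ?a + q * exp ?b"
    using convex_onD[OF exp_convex, of q ?a ?b] assms by simp
  also have "\<dots> = (1 - p) * exp a + p * exp b"
    using assms by (simp add: exp_diff)
  also have "(1 - q) * ?a + q * ?b = ((1 - q) * a + q * b) - bernoulli_kl q p"
    by (simp add: bernoulli_kl_def algebra_simps)
  finally show ?thesis by (simp only: exp_diff) (simp add: pos_divide_le_eq mult.commute)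
qed

text \<open>The Gibbs variational inequality for product measures.\<close>

lemma exp_bexp_le:
  fixes p :: real
  assumes p: "0 < p" "p < 1" and q: "\<And>i. 0 < q i \<and> q i < 1"
  shows "exp (bexp q n g) \<le> exp (\<Sum>i=1..n. bernoulli_kl (q i) p) * bexp (\<lambda>_. p) n (\<lambda>B. exp (g B))"
proof (induction n arbitrary: g)
  case (Suc n)
  let ?q = "q (Suc n)"
  let ?g = "\<lambda>B. (1 - ?q) * g B + ?q * g (insert (Suc n) B)"
  have "bexp (\<lambda>_. p) n (\<lambda>B. exp (?g B))
    \<le> bexp (\<lambda>_. p) n (\<lambda>B. exp (bernoulli_kl ?q p) * ((1 - p) * exp (g B) + p * exp (g (insert (Suc n) B))))"
    using p q by (intro bexp_mono exp_bernoulli_mean_le) auto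
  also have "\<dots> = exp (bernoulli_kl ?q p) * bexp (\<lambda>_. p) (Suc n) (\<lambda>B. exp (g B))"
    by (simp add: bexp_cmult)
  finally have "exp (\<Sum>i=1..n. bernoulli_kl (q i) p) * bexp (\<lambda>_. p) n (\<lambda>B. exp (?g B))
    \<le> exp (\<Sum>i=1..n. bernoulli_kl (q i) p) * (exp (bernoulli_kl ?q p) * bexp (\<lambda>_. p) (Suc n) (\<lambda>B. exp (g B)))"
    by (rule mult_left_mono) simp
  then have "exp (bexp q n ?g) \<le> exp (\<Sum>i=1..n. bernoulli_kl (q i) p) * (exp (bernoulli_kl ?q p) * bexp (\<lambda>_. p) (Suc n) (\<lambda>B. exp (g B)))"
    using Suc.IH[of ?g] by (rule order_trans[rotated])
  then show ?case by (simp add: exp_add mult.assoc)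
qed simp

text \<open>Apply \<open>exp_bexp_le\<close> to \<open>l\<close> times the indicator of
  \<open>P\<close>. If \<open>P\<close> had probability below \<open>exp (- l)\<close> under
  \<open>p\<close>, the exponential moment would be at most 2, which contradicts the assumption on
  \<open>l\<close>.\<close>

lemma prob_ge_change_of_measure:
  fixes p l :: real
  assumes p: "0 < p" "p < 1" and q: "\<And>i. 0 < q i \<and> q i < 1"
    and l: "(\<Sum>i=1..n. bernoulli_kl (q i) p) + ln 2 < l * bexp q n (\<lambda>B. of_bool (P B))"
  shows "exp (- l) \<le> bexp (\<lambda>_. p) n (\<lambda>B. of_bool (P B))"
proof (rule ccontr)
  let ?K = "\<Sum>i=1..n. bernoulli_kl (q i) p"
  assume "\<not> exp (- l) \<le> bexp (\<lambda>_. p) n (\<lambda>B. of_bool (P B))"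
  then have small: "exp l * bexp (\<lambda>_. p) n (\<lambda>B. of_bool (P B)) < 1"
    by (simp add: exp_minus field_simps)
  have "bexp (\<lambda>_. p) n (\<lambda>B. exp (l * of_bool (P B))) \<le> bexp (\<lambda>_. p) n (\<lambda>B. 1 + exp l * of_bool (P B))"
    using p by (intro bexp_mono) auto
  also have "\<dots> = 1 + exp l * bexp (\<lambda>_. p) n (\<lambda>B. of_bool (P B))"
    by (simp only: bexp_add bexp_cmult bexp_const)
  also have "\<dots> \<le> 2" using small by simp
  finally have "exp ?K * bexp (\<lambda>_. p) n (\<lambda>B. exp (l * of_bool (P B))) \<le> exp ?K * 2"
    by (rule mult_left_mono) simp
  then have "exp (bexp q n (\<lambda>B. l * of_bool (P B))) \<le> exp ?K * 2"
    using exp_bexp_le[OF p q, where g = "\<lambda>B. l * of_bool (P B)"] by (rule order_trans[rotated])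
  also have "\<dots> = exp (?K + ln 2)" by (simp add: exp_add)
  finally show False using l by (simp add: bexp_cmult)
qed

section \<open>Entropy and product shift of small tilts\<close>

lemma ln_one_plus_le_cubic:
  fixes x :: real
  assumes "-1 < x"
  shows "ln (1 + x) \<le> x - x\<^sup>2 / 2 + x ^ 3 / 3"
proof -
  define f where "f = (\<lambda>x::real. x - x\<^sup>2 / 2 + x ^ 3 / 3 - ln (1 + x))"
  \<comment> \<open>The derivative has the sign of \<open>y\<close>, so \<open>f\<close> is minimal
    at 0, where it vanishes.\<close>
  have deriv: "(f has_real_derivative (y ^ 3 / (1 + y))) (at y)" if "-1 < y" for y
    unfolding f_def using that
    by (auto intro!: derivative_eq_intros simp: field_simps) (simp add: power2_eq_square power3_eq_cube algebra_simps)
  have "f 0 \<le> f x"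
  proof (cases "0 \<le> x")
    case True
    then show ?thesis
      by (intro DERIV_nonneg_imp_nondecreasing[of 0 x f]) (auto intro!: exI deriv)
  next
    case False
    have "\<exists>z. (f has_real_derivative z) (at y) \<and> z \<le> 0" if "x \<le> y" "y \<le> 0" for y
      using that assms by (intro exI[of _ "y ^ 3 / (1 + y)"] conjI deriv) (auto simp: divide_le_0_iff power_le_zero_eq)
    then show ?thesis
      using False by (intro DERIV_nonpos_imp_nonincreasing[of x 0 f]) auto
  qed
  then show ?thesis by (simp add: f_def)
qed

text \<open>With \<open>q = p * (1 + l)\<close> and \<open>1 - q = (1 - p) * (1 - v)\<close>, both
  logarithms are expanded to third order. The relation \<open>(1 - p) * v = p * l\<close> cancels
  the linear terms and gives the exact quadratic one; \<open>p \<le> 1 / 2\<close> yields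
  \<open>\<bar>v\<bar> \<le> \<bar>l\<bar>\<close>, which bounds the rest.\<close>

lemma bernoulli_kl_le:
  fixes p l :: real
  assumes p: "0 < p" "p \<le> 1 / 2" and l: "\<bar>l\<bar> < 1"
  shows "bernoulli_kl (p * (1 + l)) p \<le> p * l\<^sup>2 / (2 * (1 - p)) * (1 + 2 * \<bar>l\<bar>)"
proof -
  define v where "v = p * l / (1 - p)"
  have v: "(1 - p) * v = p * l" using p by (simp add: v_def)
  have "\<bar>v\<bar> = p / (1 - p) * \<bar>l\<bar>" using p by (simp add: v_def abs_mult)
  also have "\<dots> \<le> 1 * \<bar>l\<bar>" using p by (intro mult_right_mono) (auto simp: field_simps)
  finally have vl: "\<bar>v\<bar> \<le> \<bar>l\<bar>" by simp
  have one_v: "(1 - p * (1 + l)) / (1 - p) = 1 + - v" "1 - p * (1 + l) = (1 - p) * (1 - v)"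
    using p by (simp_all add: v_def field_simps)
  have "bernoulli_kl (p * (1 + l)) p = p * (1 + l) * ln (1 + l) + (1 - p) * (1 - v) * ln (1 + - v)"
    unfolding bernoulli_kl_def one_v using p by simp
  also have "\<dots> \<le> p * (1 + l) * (l - l\<^sup>2 / 2 + l ^ 3 / 3) + (1 - p) * (1 - v) * ((- v) - (- v)\<^sup>2 / 2 + (- v) ^ 3 / 3)"
    using p l vl by (intro add_mono mult_left_mono ln_one_plus_le_cubic mult_nonneg_nonneg) auto
  also have "\<dots> = p * (l + l\<^sup>2 / 2 - l ^ 3 / 6 + l ^ 4 / 3) + (1 - p) * v * (- 1 + v / 2 + v\<^sup>2 / 6 + v ^ 3 / 3)"
    by (simp add: power2_eq_square power3_eq_cube power4_eq_xxxx field_simps)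
  also have "\<dots> = p * l * (l + v) / 2 + p * l * (- (l\<^sup>2) / 6 + l ^ 3 / 3 + v\<^sup>2 / 6 + v ^ 3 / 3)"
    unfolding v by (simp add: power2_eq_square power3_eq_cube power4_eq_xxxx field_simps)
  also have "p * l * (l + v) / 2 = p * l\<^sup>2 / (2 * (1 - p))"
    using p by (simp add: v_def power2_eq_square field_simps)
  also have "p * l * (- (l\<^sup>2) / 6 + l ^ 3 / 3 + v\<^sup>2 / 6 + v ^ 3 / 3) \<le> p * \<bar>l\<bar> * l\<^sup>2"
  proof -
    have v2: "v\<^sup>2 \<le> l\<^sup>2" using vl by (simp add: abs_le_square_iff)
    have "\<bar>v\<bar> ^ 3 \<le> \<bar>l\<bar> ^ 3" using vl by (intro power_mono) auto
    moreover have "\<bar>l\<bar> ^ 3 \<le> \<bar>l\<bar> ^ 2" using l by (intro power_decreasing) auto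
    ultimately have "\<bar>v ^ 3\<bar> \<le> l\<^sup>2" "\<bar>l ^ 3\<bar> \<le> l\<^sup>2"
      unfolding power_abs by (simp_all only: power2_abs)
    \<comment> \<open>The coefficients 1/6, 1/3, 1/6 and 1/3 add up to 1.\<close>
    with v2 have "\<bar>- (l\<^sup>2) / 6 + l ^ 3 / 3 + v\<^sup>2 / 6 + v ^ 3 / 3\<bar> \<le> l\<^sup>2"
      using zero_le_power2[of l] zero_le_power2[of v] by linarith
    then have "\<bar>p * l * (- (l\<^sup>2) / 6 + l ^ 3 / 3 + v\<^sup>2 / 6 + v ^ 3 / 3)\<bar> \<le> p * \<bar>l\<bar> * l\<^sup>2"
      unfolding abs_mult using p by (intro mult_mono) auto
    then show ?thesis by linarith
  qed
  also have "p * \<bar>l\<bar> * l\<^sup>2 \<le> p * l\<^sup>2 / (2 * (1 - p)) * (2 * \<bar>l\<bar>)"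
  proof -
    have "p * \<bar>l\<bar> * l\<^sup>2 * 1 \<le> p * \<bar>l\<bar> * l\<^sup>2 * (1 / (1 - p))"
      using p by (intro mult_left_mono) auto
    also have "p * \<bar>l\<bar> * l\<^sup>2 * (1 / w) = p * l\<^sup>2 / (2 * w) * (2 * \<bar>l\<bar>)" for w :: real
      by (cases "w = 0") (simp_all add: field_simps)
    finally show ?thesis by simp
  qed
  finally show ?thesis by (simp add: distrib_left)
qed

text \<open>For \<open>\<sigma> = 1\<close> the product is at least one plus the sum. For
  \<open>\<sigma> = -1\<close>, with \<open>s\<close> the sum, the product is at most
  \<open>exp (- s) \<le> 1 / (1 + s) \<le> 1 - s + s\<^sup>2\<close>, and
  \<open>s \<le> card e * \<mu>\<close>.\<close>

lemma tilted_prod_ge: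
  fixes \<sigma> \<mu> :: real and m :: "'a \<Rightarrow> real"
  assumes \<sigma>: "\<sigma> = 1 \<or> \<sigma> = -1" and m: "\<And>x. x \<in> e \<Longrightarrow> 0 \<le> m x \<and> m x \<le> \<mu>" and \<mu>: "0 \<le> \<mu>" "\<mu> \<le> 1"
  shows "(1 - real (card e) * \<mu>) * (\<Sum>x\<in>e. m x) \<le> \<sigma> * ((\<Prod>x\<in>e. 1 + \<sigma> * m x) - 1)"
proof -
  let ?s = "\<Sum>x\<in>e. m x"
  have s: "0 \<le> ?s" "?s \<le> card e * \<mu>"
    using m sum_bounded_above[of e m \<mu>] by (auto intro: sum_nonneg)
  consider "\<sigma> = 1" | "\<sigma> = -1" using \<sigma> by auto
  then show ?thesis
  proof cases
    case 1
    have "1 + (\<Sum>x\<in>A. m x) \<le> (\<Prod>x\<in>A. 1 + m x)" if "A \<subseteq> e" for A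
      using that
    proof (induction A rule: infinite_finite_induct)
      case (insert x A)
      have "0 \<le> m x" "0 \<le> (\<Sum>x\<in>A. m x)" using m insert.prems by (auto intro!: sum_nonneg)
      then have "1 + (m x + (\<Sum>x\<in>A. m x)) \<le> (1 + m x) * (1 + (\<Sum>x\<in>A. m x))" by (simp add: algebra_simps)
      also have "\<dots> \<le> (1 + m x) * (\<Prod>x\<in>A. 1 + m x)"
        using insert \<open>0 \<le> m x\<close> by (intro mult_left_mono) auto
      finally show ?case using insert.hyps by simp
    qed auto
    from this[of e] have "?s \<le> \<sigma> * ((\<Prod>x\<in>e. 1 + \<sigma> * m x) - 1)" using 1 by simp
    moreover have "(1 - real (card e) * \<mu>) * ?s \<le> 1 * ?s" using s \<mu> by (intro mult_right_mono) auto
    ultimately show ?thesis by simp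
  next
    case 2
    have "(\<Prod>x\<in>e. 1 + \<sigma> * m x) \<le> (\<Prod>x\<in>e. exp (- m x))"
      using m \<mu> 2 exp_ge_add_one_self[of "- m _"] by (intro prod_mono) (auto intro: order_trans)
    also have "\<dots> = exp (- ?s)"
    proof (cases "finite e")
      case True
      then show ?thesis by (simp add: exp_sum sum_negf[symmetric])
    qed simp
    also have "\<dots> \<le> 1 / (1 + ?s)"
      using s exp_ge_add_one_self[of ?s] by (simp add: exp_minus field_simps)
    also have "\<dots> \<le> 1 - (1 - ?s) * ?s"
    proof -
      have "(1 - (1 - ?s) * ?s) * (1 + ?s) = 1 + ?s * ?s * ?s" by (simp add: algebra_simps)
      also have "\<dots> \<ge> 1" using s by simp
      finally show ?thesis using s by (simp add: pos_divide_le_eq)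
    qed
    also have "\<dots> \<le> 1 - (1 - card e * \<mu>) * ?s"
      using s by (intro diff_left_mono mult_right_mono) auto
    finally show ?thesis using 2 by simp
  qed
qed

section \<open>First and second moments under a tilted measure\<close>

context codegree_bounded
begin

lemma bexp_weight_inside: "bexp q N (weight_inside H) = (\<Sum>e\<in>edges H. weight H e * (\<Prod>x\<in>e. q x))"
proof -
  have "bexp q N (weight_inside H) = bexp q N (\<lambda>B. \<Sum>e\<in>edges H. weight H e * of_bool (e \<subseteq> B))"
    by (intro bexp_cong) (rule weight_inside_eq)
  then show ?thesis by (simp only: bexp_sum bexp_cmult bexp_superset edge_subset cong: sum.cong)
qed

text \<open>Double counting of the incidences between vertices and edges.\<close>

lemma sum_edges_sum:
  "(\<Sum>e\<in>edges H. weight H e * (\<Sum>x\<in>e. m x)) = (\<Sum>x=1..N. set_degree H {x} * m x)"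
proof -
  have "(\<Sum>e\<in>edges H. weight H e * (\<Sum>x\<in>e. m x)) = (\<Sum>e\<in>edges H. \<Sum>x=1..N. weight H e * of_bool ({x} \<subseteq> e) * m x)"
  proof (intro sum.cong refl)
    fix e assume e: "e \<in> edges H"
    have "(\<Sum>x\<in>e. m x) = (\<Sum>x\<in>{x\<in>{1..N}. x \<in> e}. m x)"
      using edge_subset[OF e] by (intro sum.cong) auto
    also have "\<dots> = (\<Sum>x=1..N. of_bool ({x} \<subseteq> e) * m x)"
      unfolding sum.inter_filter[OF finite_atLeastAtMost] by (intro sum.cong refl) simp
    finally show "weight H e * (\<Sum>x\<in>e. m x) = (\<Sum>x=1..N. weight H e * of_bool ({x} \<subseteq> e) * m x)"
      by (simp only: sum_distrib_left mult.assoc)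
  qed
  also have "\<dots> = (\<Sum>x=1..N. set_degree H {x} * m x)"
    unfolding set_degree_eq sum_distrib_right by (rule sum.swap)
  finally show ?thesis .
qed

text \<open>Sum \<open>tilted_prod_ge\<close> over the edges: to first order the tilt moves the mean
  in direction \<open>\<sigma>\<close> by the degree-weighted sum of \<open>m\<close>, and the
  higher orders cost at most a relative error \<open>k * \<mu>\<close>.\<close>

lemma tilted_mean_ge:
  fixes \<sigma> \<mu> p :: real
  assumes \<sigma>: "\<sigma> = 1 \<or> \<sigma> = -1" and m: "\<And>x. 0 \<le> m x \<and> m x \<le> \<mu>" and \<mu>: "\<mu> \<le> 1" and p: "0 \<le> p"
  shows "(1 - k * \<mu>) * p ^ k * (\<Sum>x=1..N. set_degree H {x} * m x)
    \<le> \<sigma> * (bexp (\<lambda>x. p * (1 + \<sigma> * m x)) N (weight_inside H) - p ^ k * total_weight H)"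
proof -
  have "0 \<le> \<mu>" using m[of 0] by linarith
  have "(1 - k * \<mu>) * p ^ k * (\<Sum>x=1..N. set_degree H {x} * m x)
     = (\<Sum>e\<in>edges H. weight H e * p ^ k * ((1 - k * \<mu>) * (\<Sum>x\<in>e. m x)))"
    unfolding sum_edges_sum[symmetric] sum_distrib_left[of "_ * _"] by (simp add: mult_ac)
  also have "\<dots> \<le> (\<Sum>e\<in>edges H. weight H e * p ^ k * (\<sigma> * ((\<Prod>x\<in>e. 1 + \<sigma> * m x) - 1)))"
  proof (intro sum_mono mult_left_mono)
    fix e assume "e \<in> edges H"
    then show "(1 - k * \<mu>) * (\<Sum>x\<in>e. m x) \<le> \<sigma> * ((\<Prod>x\<in>e. 1 + \<sigma> * m x) - 1)"
      using tilted_prod_ge[OF \<sigma>, of e m \<mu>] m \<mu> \<open>0 \<le> \<mu>\<close> card_edge[of e] by simp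
  qed (use p weight_nonneg in auto)
  also have "\<dots> = (\<Sum>e\<in>edges H. \<sigma> * (weight H e * (\<Prod>x\<in>e. p * (1 + \<sigma> * m x)) - p ^ k * weight H e))"
  proof -
    have "w * c * (\<sigma> * (R - 1)) = \<sigma> * (w * (c * R) - c * w)" for w c R :: real by (simp add: algebra_simps)
    then show ?thesis by (intro sum.cong refl) (simp only: prod.distrib prod_constant card_edge)
  qed
  also have "\<dots> = \<sigma> * (bexp (\<lambda>x. p * (1 + \<sigma> * m x)) N (weight_inside H) - p ^ k * total_weight H)"
    unfolding bexp_weight_inside total_weight_def
    by (simp only: sum_distrib_left[symmetric] sum_subtractf)
  finally show ?thesis .
qed

text \<open>Disjoint edges have covariance 0. For meeting edges it is at most
  \<open>Q e * Q (f - e)\<close>, and since all inclusion probabilities are at most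
  \<open>P\<close>, the sum over \<open>f\<close> is bounded by \<open>colliding_weight_le\<close>
  with empty \<open>I\<close> and \<open>U = e\<close>.\<close>

lemma weight_inside_variance_le:
  fixes P :: real
  assumes q: "\<And>x. 0 \<le> q x \<and> q x \<le> P" and P: "0 < P" "P \<le> 1" and kP: "real k \<le> P * N"
  shows "bexp q N (\<lambda>B. (weight_inside H B - bexp q N (weight_inside H))\<^sup>2)
    \<le> P ^ k * total_weight H * (C * real N ^ r * P ^ k * (k * (k / (P * N)) + (k / N) ^ r / P ^ k))"
    (is "_ \<le> _ * ?\<gamma>")
proof -
  define m where "m = bexp q N (weight_inside H)"
  define Q where "Q e = (\<Prod>x\<in>e. q x)" for e
  have Q_nonneg: "0 \<le> Q e" for e using q by (auto simp: Q_def intro: prod_nonneg)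
  have Q_le: "Q e \<le> P ^ card e" for e
  proof -
    have "Q e \<le> (\<Prod>x\<in>e. P)" unfolding Q_def using q by (intro prod_mono) auto
    then show ?thesis by simp
  qed
  have "bexp q N (\<lambda>B. (weight_inside H B - m)\<^sup>2)
     = bexp q N (\<lambda>B. (\<Sum>e\<in>edges H. \<Sum>f\<in>edges H. weight H e * weight H f * of_bool (e \<union> f \<subseteq> B)) + (m * m - (2 * m) * weight_inside H B))"
  proof (intro bexp_cong)
    fix B
    have "(weight_inside H B)\<^sup>2 = (\<Sum>e\<in>edges H. \<Sum>f\<in>edges H. weight H e * weight H f * of_bool (e \<union> f \<subseteq> B))"
      unfolding weight_inside_eq power2_eq_square sum_product by (intro sum.cong refl) auto
    then show "(weight_inside H B - m)\<^sup>2 = (\<Sum>e\<in>edges H. \<Sum>f\<in>edges H. weight H e * weight H f * of_bool (e \<union> f \<subseteq> B)) + (m * m - (2 * m) * weight_inside H B)"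
      by (simp only: power2_diff) (simp add: power2_eq_square)
  qed
  also have "\<dots> = (\<Sum>e\<in>edges H. \<Sum>f\<in>edges H. weight H e * weight H f * Q (e \<union> f)) - m * m"
  proof -
    have "bexp q N (\<lambda>B. of_bool (e \<union> f \<subseteq> B)) = Q (e \<union> f)" if "e \<in> edges H" "f \<in> edges H" for e f
      unfolding Q_def using that edge_subset by (intro bexp_superset) auto
    then have "(\<Sum>e\<in>edges H. \<Sum>f\<in>edges H. weight H e * weight H f * bexp q N (\<lambda>B. of_bool (e \<union> f \<subseteq> B)))
        = (\<Sum>e\<in>edges H. \<Sum>f\<in>edges H. weight H e * weight H f * Q (e \<union> f))"
      by (intro sum.cong refl) simp
    then show ?thesis
      unfolding bexp_add bexp_diff bexp_const bexp_cmult m_def[symmetric] bexp_sum by simp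
  qed
  also have "m * m = (\<Sum>e\<in>edges H. \<Sum>f\<in>edges H. weight H e * weight H f * (Q e * Q f))"
    unfolding m_def bexp_weight_inside sum_product Q_def by (intro sum.cong refl) (simp add: mult_ac)
  also have "(\<Sum>e\<in>edges H. \<Sum>f\<in>edges H. weight H e * weight H f * Q (e \<union> f)) - \<dots>
      = (\<Sum>e\<in>edges H. weight H e * Q e * (\<Sum>f\<in>edges H. weight H f * (Q (f - e) - Q f)))"
  proof -
    have "Q (e \<union> f) = Q e * Q (f - e)" if "e \<in> edges H" "f \<in> edges H" for e f
      unfolding Q_def using that finite_edge by (subst prod.union_disjoint[symmetric]) auto
    then show ?thesis
      by (simp add: sum_subtractf[symmetric] sum_distrib_left right_diff_distrib mult_ac cong: sum.cong)
  qed
  also have "\<dots> \<le> (\<Sum>e\<in>edges H. weight H e * P ^ k * ?\<gamma>)"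
  proof (rule sum_mono)
    fix e assume e: "e \<in> edges H"
    have "(\<Sum>f\<in>edges H. weight H f * (Q (f - e) - Q f))
        \<le> (\<Sum>f\<in>edges H. if {} \<subseteq> f \<and> (f - {}) \<inter> e \<noteq> {} then weight H f * P ^ card (f - {} - e) else 0)"
    proof (rule sum_mono)
      fix f assume f: "f \<in> edges H"
      show "weight H f * (Q (f - e) - Q f) \<le> (if {} \<subseteq> f \<and> (f - {}) \<inter> e \<noteq> {} then weight H f * P ^ card (f - {} - e) else 0)"
      proof (cases "f \<inter> e = {}")
        case True
        then have "f - e = f" by auto
        then show ?thesis using True by simp
      next
        case False
        have "Q (f - e) - Q f \<le> P ^ card (f - e)" using Q_le[of "f - e"] Q_nonneg[of f] by linarith
        then show ?thesis using False weight_nonneg[OF f] by (simp add: mult_left_mono)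
      qed
    qed
    also have "\<dots> = (\<Sum>f | f \<in> edges H \<and> {} \<subseteq> f \<and> (f - {}) \<inter> e \<noteq> {}. weight H f * P ^ card (f - {} - e))"
      by (rule sum.inter_filter[symmetric]) simp
    also have "\<dots> \<le> ?\<gamma>"
      using colliding_weight_le[of "{}" e k P] edge_subset[OF e] card_edge[OF e] P kP by simp
    finally have "(\<Sum>f\<in>edges H. weight H f * (Q (f - e) - Q f)) \<le> ?\<gamma>" .
    moreover have "weight H e * Q e \<le> weight H e * P ^ k"
      using Q_le[of e] card_edge[OF e] weight_nonneg[OF e] by (simp add: mult_left_mono)
    moreover have "0 \<le> ?\<gamma>" using C_nonneg P by (intro mult_nonneg_nonneg add_nonneg_nonneg) auto
    ultimately show "weight H e * Q e * (\<Sum>f\<in>edges H. weight H f * (Q (f - e) - Q f)) \<le> weight H e * P ^ k * ?\<gamma>"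
      using Q_nonneg[of e] weight_nonneg[OF e]
      by (meson mult_left_mono mult_right_mono mult_nonneg_nonneg order_trans)
  qed
  also have "\<dots> = P ^ k * total_weight H * ?\<gamma>"
    unfolding total_weight_def by (simp only: sum_distrib_right[symmetric]) (simp only: mult.commute mult.left_commute)
  finally show ?thesis unfolding m_def .
qed

text \<open>Under the tilt by \<open>m\<close> the mean of \<open>\<sigma>\<close> times the
  deviation is at least \<open>t + s\<close>. Chebyshev's inequality then gives the event
  probability at least \<open>1 - v\<close>, and \<open>prob_ge_change_of_measure\<close> transfers
  this to \<open>p\<close> at the entropy cost from \<open>bernoulli_kl_le\<close>.\<close>

lemma deviation_tail_ge:
  fixes \<sigma> \<mu> p t s l :: real
  assumes \<sigma>: "\<sigma> = 1 \<or> \<sigma> = -1" and p: "0 < p" "p < 1 / 2" and m: "\<And>x. 0 \<le> m x \<and> m x \<le> \<mu>"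
    and \<mu>: "\<mu> < 1" and kp: "real k \<le> p * N" and s: "0 < s"
    and shift: "t + s \<le> (1 - k * \<mu>) * p ^ k * (\<Sum>x=1..N. set_degree H {x} * m x)"
    and v: "(2 * p) ^ k * total_weight H * (C * real N ^ r * (2 * p) ^ k * (k * (k / (2 * p * N)) + (k / N) ^ r / (2 * p) ^ k)) \<le> v * s\<^sup>2"
    and l: "0 \<le> l" "(1 + 2 * \<mu>) * (p / (2 * (1 - p)) * (\<Sum>x=1..N. (m x)\<^sup>2)) + ln 2 < l * (1 - v)"
  shows "exp (- l) \<le> bexp (\<lambda>_. p) N (\<lambda>B. of_bool (t \<le> \<sigma> * deviation k p H B))"
proof -
  define q where "q x = p * (1 + \<sigma> * m x)" for x
  define E where "E = bexp q N (weight_inside H)"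
  have abs: "\<bar>\<sigma> * m x\<bar> = m x" "\<bar>\<sigma> * m x\<bar> < 1" for x using \<sigma> m[of x] \<mu> by auto
  \<comment> \<open>A tilt by less than a factor 2 keeps all probabilities at most
    \<open>2 * p\<close>, which is the \<open>P\<close> of the variance bound.\<close>
  have q: "0 < q x \<and> q x \<le> 2 * p" for x
    using abs[of x] p unfolding q_def by (auto simp: abs_less_iff intro!: mult_pos_pos)
  have q1: "0 < q x \<and> q x < 1" for x using q[of x] p by auto
  have "1 - v \<le> bexp q N (\<lambda>B. of_bool (t \<le> \<sigma> * deviation k p H B))"
  proof -
    have "bexp q N (\<lambda>B. 1 - of_bool (t \<le> \<sigma> * deviation k p H B))
      \<le> bexp q N (\<lambda>B. 1 / s\<^sup>2 * (weight_inside H B - E)\<^sup>2)"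
    proof (intro bexp_mono)
      fix B
      show "1 - of_bool (t \<le> \<sigma> * deviation k p H B) \<le> 1 / s\<^sup>2 * (weight_inside H B - E)\<^sup>2"
      proof (cases "t \<le> \<sigma> * deviation k p H B")
        case False
        have "t + s \<le> \<sigma> * (E - p ^ k * total_weight H)"
          unfolding E_def q_def using shift p \<mu> by (intro order_trans[OF _ tilted_mean_ge[OF \<sigma> m]]) auto
        then have "s \<le> \<sigma> * (E - weight_inside H B)"
          using False unfolding deviation_def by (simp add: algebra_simps)
        then have "s\<^sup>2 \<le> (\<sigma> * (E - weight_inside H B))\<^sup>2" using s by (intro power_mono) auto
        also have "\<dots> = (weight_inside H B - E)\<^sup>2" using \<sigma> by (auto simp: power2_commute)
        finally show ?thesis using s False by (simp add: field_simps)
      qed simp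
    qed (use q1 less_imp_le in auto)
    also have "\<dots> \<le> 1 / s\<^sup>2 * (v * s\<^sup>2)"
      unfolding bexp_cmult E_def using q p kp
      by (intro mult_left_mono order_trans[OF weight_inside_variance_le v]) (auto intro: less_imp_le)
    finally show ?thesis using s by (simp only: bexp_diff bexp_const) simp
  qed
  then have "l * (1 - v) \<le> l * bexp q N (\<lambda>B. of_bool (t \<le> \<sigma> * deviation k p H B))"
    using l by (intro mult_left_mono)
  moreover have "(\<Sum>x=1..N. bernoulli_kl (q x) p) \<le> (1 + 2 * \<mu>) * (p / (2 * (1 - p)) * (\<Sum>x=1..N. (m x)\<^sup>2))"
  proof -
    have "bernoulli_kl (q x) p \<le> (1 + 2 * \<mu>) * (p / (2 * (1 - p)) * (m x)\<^sup>2)" for x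
    proof -
      have "bernoulli_kl (q x) p \<le> p * (\<sigma> * m x)\<^sup>2 / (2 * (1 - p)) * (1 + 2 * \<bar>\<sigma> * m x\<bar>)"
        unfolding q_def using p abs[of x] by (intro bernoulli_kl_le) auto
      also have "(\<sigma> * m x)\<^sup>2 = (m x)\<^sup>2" using abs(1)[of x] by (metis power2_abs)
      also have "p * (m x)\<^sup>2 / (2 * (1 - p)) * (1 + 2 * \<bar>\<sigma> * m x\<bar>) \<le> p * (m x)\<^sup>2 / (2 * (1 - p)) * (1 + 2 * \<mu>)"
        unfolding abs using p m[of x] by (intro mult_left_mono) auto
      finally show ?thesis by (simp add: mult_ac)
    qed
    then show ?thesis by (simp only: sum_distrib_left) (intro sum_mono)
  qed
  ultimately show ?thesis
    using l p q1 by (intro prob_ge_change_of_measure[where q = q]) auto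
qed

end

section \<open>Tail bounds at the Gaussian rate\<close>

text \<open>The exponent of the theorem without its sign and without the factor
  \<open>1 + o(1)\<close>.\<close>

definition gaussian_rate :: "nat \<Rightarrow> weighted_hypergraph \<Rightarrow> real \<Rightarrow> real \<Rightarrow> real" where
  "gaussian_rate N H p \<delta> = \<delta>\<^sup>2 * p * (total_weight H)\<^sup>2
     / (2 * (1 - p) * ((avg_degree N H)\<^sup>2 + degree_variance N H) * real N)"

locale high_degree_variance = codegree_bounded +
  assumes r_ge_2: "2 \<le> r" and C_ge_1: "1 \<le> C"
    and variance_ge: "real N ^ (2 * r - 2) / C \<le> degree_variance N H"
begin

abbreviation deg :: "nat \<Rightarrow> real" where "deg x \<equiv> set_degree H {x}"

text \<open>By \<open>degree_square_sum_eq\<close> this is the bracket in the denominator of the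
  rate times \<open>N\<close>; it arises as the quadratic cost of tilts and thresholds proportional
  to the degrees.\<close>

definition degree_square_sum :: real where
  "degree_square_sum = (\<Sum>x=1..N. (deg x)\<^sup>2)"

abbreviation rate :: "real \<Rightarrow> real \<Rightarrow> real" where
  "rate \<equiv> gaussian_rate N H"

section \<open>Orders of magnitude of degrees, total weight and rate\<close>

lemma N_power: "real N ^ (2 * r - 2) = (real N ^ (r - 1))\<^sup>2" "real N ^ r = real N * real N ^ (r - 1)"
proof -
  obtain j where j: "r = Suc j" using r_ge_2 by (cases r) auto
  show "real N ^ (2 * r - 2) = (real N ^ (r - 1))\<^sup>2" "real N ^ r = real N * real N ^ (r - 1)"
    by (simp_all add: j power_mult[symmetric] mult.commute)
qed

lemma deg_le: "deg x \<le> C * real N ^ (r - 1)"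
proof (cases "x \<in> {1..N}")
  case True
  then show ?thesis using set_degree_le[of "{x}"] r_ge_2 by simp
next
  case False
  then have "{e. e \<in> edges H \<and> {x} \<subseteq> e} = {}" using edge_subset by blast
  then have "deg x = 0" by (simp only: set_degree_def sum.empty)
  then show ?thesis using C_nonneg by simp
qed

lemma sum_deg: "(\<Sum>x=1..N. deg x) = k * total_weight H"
proof -
  have "(\<Sum>x=1..N. deg x) = (\<Sum>e\<in>edges H. weight H e * (\<Sum>x\<in>e. 1))"
    using sum_edges_sum[of "\<lambda>_. 1"] by simp
  then show ?thesis by (simp add: card_edge total_weight_def sum_distrib_left mult.commute)
qed

lemma degree_square_sum_eq:
  "degree_square_sum = ((avg_degree N H)\<^sup>2 + degree_variance N H) * N"
proof -
  let ?a = "avg_degree N H"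
  have a: "(\<Sum>x=1..N. deg x) = ?a * N" using N_pos by (simp add: avg_degree_def)
  have "degree_variance N H * N = (\<Sum>x=1..N. (deg x - ?a)\<^sup>2)"
    using N_pos by (simp add: degree_variance_def)
  also have "\<dots> = (\<Sum>x=1..N. (deg x)\<^sup>2 + ?a\<^sup>2 - (2 * ?a) * deg x)"
    by (simp add: power2_diff mult_ac)
  also have "\<dots> = degree_square_sum + N * ?a\<^sup>2 - (2 * ?a) * (\<Sum>x=1..N. deg x)"
    unfolding degree_square_sum_def by (simp only: sum.distrib sum_subtractf sum_distrib_left) simp
  finally show ?thesis by (simp only: a) (simp add: algebra_simps power2_eq_square)
qed

lemma rate_eq: "rate p \<delta> = \<delta>\<^sup>2 * p * (total_weight H)\<^sup>2 / (2 * (1 - p) * degree_square_sum)"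
  by (simp add: gaussian_rate_def degree_square_sum_eq mult.assoc)

text \<open>The squared average degree is nonnegative, so the variance hypothesis alone bounds the
  sum from below.\<close>

lemma degree_square_sum_ge: "real N * (real N ^ (r - 1))\<^sup>2 / C \<le> degree_square_sum"
proof -
  have "real N * (real N ^ (2 * r - 2) / C) \<le> real N * degree_variance N H"
    using variance_ge by (intro mult_left_mono) auto
  also have "\<dots> \<le> degree_square_sum" by (simp add: degree_square_sum_eq algebra_simps)
  finally show ?thesis by (simp add: N_power(1))
qed

lemma degree_square_sum_pos: "0 < degree_square_sum"
proof -
  have "0 < real N * (real N ^ (r - 1))\<^sup>2 / C" using N_pos C_ge_1 by simp
  then show ?thesis using degree_square_sum_ge by linarith
qed

lemma degree_square_sum_le_total: "degree_square_sum \<le> C * real N ^ (r - 1) * (k * total_weight H)"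
proof -
  have "degree_square_sum \<le> (\<Sum>x=1..N. C * real N ^ (r - 1) * deg x)"
    unfolding degree_square_sum_def power2_eq_square
    by (intro sum_mono mult_right_mono deg_le set_degree_nonneg)
  then show ?thesis by (simp only: sum_distrib_left[symmetric] sum_deg)
qed

lemma k_pos: "0 < k" using r_ge_2 r_le_k by simp

lemma total_weight_nonneg: "0 \<le> total_weight H"
  unfolding total_weight_def by (intro sum_nonneg weight_nonneg)

lemma k_total_weight_le: "k * total_weight H \<le> C * (real N * real N ^ (r - 1))"
proof -
  have "(\<Sum>x=1..N. deg x) \<le> (\<Sum>x=1..N. C * real N ^ (r - 1))" by (intro sum_mono deg_le)
  then show ?thesis unfolding sum_deg by (simp add: mult_ac)
qed

lemma total_weight_le: "total_weight H \<le> C * (real N * real N ^ (r - 1))"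
proof -
  have "1 * total_weight H \<le> k * total_weight H"
    using k_pos total_weight_nonneg by (intro mult_right_mono) auto
  then show ?thesis using k_total_weight_le by linarith
qed

text \<open>The sum of squared degrees is bounded below through the variance and above by maximum
  degree times total degree; comparing the two shows that large variance forces total weight of
  order \<open>N ^ r\<close>.\<close>

lemma total_weight_ge: "real N * real N ^ (r - 1) \<le> C\<^sup>2 * k * total_weight H"
proof -
  let ?n = "real N ^ (r - 1)"
  have n: "0 < ?n" using N_pos by simp
  have "real N * ?n\<^sup>2 / C \<le> C * ?n * (k * total_weight H)"
    using degree_square_sum_ge degree_square_sum_le_total by linarith
  then have "real N * ?n\<^sup>2 \<le> (C * ?n * (k * total_weight H)) * C" using C_ge_1 by (simp add: pos_divide_le_eq)
  then have "?n * (real N * ?n) \<le> ?n * (C\<^sup>2 * k * total_weight H)"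
    by (simp add: power2_eq_square mult_ac)
  then show ?thesis using n by simp
qed

lemma total_weight_pos: "0 < total_weight H"
proof (rule ccontr)
  assume "\<not> 0 < total_weight H"
  then have "total_weight H = 0" using total_weight_nonneg by simp
  moreover have "0 < real N * real N ^ (r - 1)" using N_pos by simp
  ultimately show False using total_weight_ge by simp
qed

text \<open>Both the tilt of the lower bound and the exponent of the upper bound are of this order.\<close>

lemma tilt_le: "total_weight H / degree_square_sum * (real N ^ (r - 1)) \<le> C\<^sup>2"
proof -
  let ?n = "real N ^ (r - 1)"
  have "total_weight H * ?n \<le> C * (real N * ?n) * ?n"
    using total_weight_le by (intro mult_right_mono) auto
  also have "\<dots> = C\<^sup>2 * (real N * ?n\<^sup>2 / C)" using C_ge_1 by (simp add: power2_eq_square)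
  also have "\<dots> \<le> C\<^sup>2 * degree_square_sum" using degree_square_sum_ge by (intro mult_left_mono) auto
  finally show ?thesis using degree_square_sum_pos by (simp add: pos_divide_le_eq)
qed

text \<open>Together with \<open>rate_ge\<close> this puts the rate at the order of
  \<open>\<delta>\<^sup>2 * p * N\<close>, which calibrates the moment order \<open>M\<close> in the
  upper bound.\<close>

lemma rate_le:
  fixes p \<delta> :: real
  assumes "0 < p" "p < 1 / 2"
  shows "rate p \<delta> \<le> C ^ 3 * (\<delta>\<^sup>2 * p * N)"
proof -
  let ?n = "real N ^ (r - 1)"
  have "(total_weight H)\<^sup>2 \<le> (C * (real N * ?n))\<^sup>2"
    using total_weight_le total_weight_nonneg by (intro power_mono)
  also have "\<dots> = C ^ 3 * real N * (real N * ?n\<^sup>2 / C)"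
    using C_ge_1 by (simp add: power2_eq_square power3_eq_cube)
  also have "\<dots> \<le> C ^ 3 * real N * degree_square_sum"
    using C_ge_1 by (intro mult_left_mono degree_square_sum_ge) auto
  also have "\<dots> \<le> (2 * (1 - p)) * (C ^ 3 * real N * degree_square_sum)"
  proof -
    have "1 * (C ^ 3 * real N * degree_square_sum) \<le> (2 * (1 - p)) * (C ^ 3 * real N * degree_square_sum)"
      using assms C_ge_1 degree_square_sum_pos by (intro mult_right_mono) auto
    then show ?thesis by simp
  qed
  finally have "\<delta>\<^sup>2 * p * (total_weight H)\<^sup>2 \<le> \<delta>\<^sup>2 * p * ((2 * (1 - p)) * (C ^ 3 * real N * degree_square_sum))"
    using assms by (intro mult_left_mono) auto
  also have "\<dots> = C ^ 3 * (\<delta>\<^sup>2 * p * N) * (2 * (1 - p) * degree_square_sum)" by (simp only: mult_ac)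
  finally show ?thesis
    unfolding rate_eq using assms degree_square_sum_pos by (subst pos_divide_le_eq) auto
qed

lemma rate_ge:
  fixes p \<delta> :: real
  assumes "0 < p" "p < 1 / 2"
  shows "\<delta>\<^sup>2 * p * N \<le> 2 * C ^ 4 * (real k)\<^sup>2 * rate p \<delta>"
proof -
  let ?n = "real N ^ (r - 1)" and ?V = degree_square_sum and ?e = "total_weight H"
  have "real N * ?V \<le> real N * (C * ?n * (k * ?e))"
    using degree_square_sum_le_total by (intro mult_left_mono) auto
  also have "\<dots> = (real N * ?n) * (C * k * ?e)" by (simp only: mult_ac)
  also have "\<dots> \<le> (C\<^sup>2 * k * ?e) * (C * k * ?e)"
    using total_weight_nonneg C_ge_1 by (intro mult_right_mono total_weight_ge) auto
  also have "\<dots> = C ^ 3 * (real k)\<^sup>2 * ?e\<^sup>2" by (simp add: power2_eq_square power3_eq_cube)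
  also have "\<dots> \<le> C ^ 4 * (real k)\<^sup>2 * ?e\<^sup>2"
    using C_ge_1 by (intro mult_right_mono power_increasing) auto
  finally have "\<delta>\<^sup>2 * p * (real N * ?V) \<le> \<delta>\<^sup>2 * p * (C ^ 4 * (real k)\<^sup>2 * ?e\<^sup>2)"
    using assms by (intro mult_left_mono) auto
  also have "\<dots> = C ^ 4 * (real k)\<^sup>2 * (rate p \<delta> * (2 * (1 - p) * ?V))"
    unfolding rate_eq using assms degree_square_sum_pos by simp
  also have "\<dots> \<le> C ^ 4 * (real k)\<^sup>2 * (rate p \<delta> * (2 * 1 * ?V))"
  proof -
    have "0 \<le> rate p \<delta>" unfolding rate_eq using assms degree_square_sum_pos by (intro divide_nonneg_nonneg) auto
    then show ?thesis using assms C_ge_1 degree_square_sum_pos by (intro mult_left_mono mult_right_mono) auto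
  qed
  finally have "(\<delta>\<^sup>2 * p * N) * ?V \<le> (2 * C ^ 4 * (real k)\<^sup>2 * rate p \<delta>) * ?V" by (simp add: mult_ac)
  then show ?thesis using degree_square_sum_pos by simp
qed

lemma rate_pos: "0 < \<delta> \<Longrightarrow> 0 < p \<Longrightarrow> p < 1 / 2 \<Longrightarrow> 0 < rate p \<delta>"
  unfolding rate_eq using degree_square_sum_pos total_weight_pos by (intro divide_pos_pos mult_pos_pos) auto

text \<open>Apply \<open>deviation_tail_le\<close> with thresholds that exceed the degrees by
  \<open>\<eta> * N ^ (r - 1)\<close>, up to scaling. The excess costs a factor
  \<open>1 + 3 * \<eta> * C\<^sup>2\<close> in the quadratic term and pushes every ratio
  \<open>\<beta> i / b i\<close> below 1 by a fixed amount.\<close>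

lemma moderate_tail_le:
  fixes \<sigma> \<kappa> \<eta> \<delta> p :: real and M u :: nat
  assumes \<sigma>: "\<sigma> = 1 \<or> \<sigma> = -1" and p: "0 < p" "p < 1 / 2" and \<delta>: "0 < \<delta>" and \<eta>: "0 < \<eta>" "\<eta> \<le> 1"
    and \<kappa>: "2 * C\<^sup>2 * (C + 1) * \<delta> \<le> \<kappa>" and u: "real u \<le> p * N" "(k - 1) * M \<le> u"
    and small: "C * (k * (u / (p * N)) + (u / N) ^ (r - 1) / p ^ (k - 1)) \<le> \<eta> / 2"
  shows "bexp (\<lambda>_. p) N (\<lambda>B. of_bool (\<delta> * p ^ k * total_weight H \<le> \<sigma> * deviation k p H B))
    \<le> exp (- rate p \<delta> * (2 - exp \<kappa> * (1 + 3 * \<eta> * C\<^sup>2))) + N * exp (- (\<eta> / (2 * (C + 1)) * M))"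
proof -
  let ?n = "real N ^ (r - 1)" and ?V = degree_square_sum and ?e = "total_weight H"
  let ?z = "k * (u / (p * N)) + (u / N) ^ (r - 1) / p ^ (k - 1)"
  \<comment> \<open>The minimiser of the exponent with \<open>exp \<kappa>\<close> replaced by 1 and
    \<open>\<eta>\<close> by 0; its linear part is then minus twice the rate and its quadratic part
    the rate.\<close>
  define \<theta> where "\<theta> = \<delta> * ?e / (p ^ (k - 1) * (1 - p) * ?V)"
  define b where "b i = p ^ (k - 1) * (deg i + \<eta> * ?n)" for i
  define \<beta> where "\<beta> i = p ^ (k - 1) * (deg i + C * ?n * ?z)" for i
  have n: "0 < ?n" using N_pos by simp
  have p1: "0 < 1 - p" "0 < p ^ (k - 1)" using p by auto
  note V = degree_square_sum_pos
  have pk: "p ^ k = p * p ^ (k - 1)" using k_pos by (cases k) auto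
  have "bexp (\<lambda>_. p) N (\<lambda>B. of_bool (\<delta> * p ^ k * ?e \<le> \<sigma> * deviation k p H B))
    \<le> exp (- \<theta> * (\<delta> * p ^ k * ?e) + \<theta>\<^sup>2 * p * (1 - p) / 2 * exp \<kappa> * (\<Sum>i=1..N. (b i)\<^sup>2)) + (\<Sum>i=1..N. (\<beta> i / b i) ^ M)"
  proof (rule deviation_tail_le)
    show "0 \<le> \<theta>" unfolding \<theta>_def using \<delta> p1 V total_weight_nonneg by (intro divide_nonneg_nonneg mult_nonneg_nonneg) auto
    show "0 < b i" for i
      unfolding b_def using p1 n \<eta> set_degree_nonneg[of "{i}"] by (intro mult_pos_pos add_nonneg_pos) auto
    fix i
    have "\<theta> * b i = \<delta> * (?e / ?V * (deg i + \<eta> * ?n)) / (1 - p)"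
    proof -
      have "\<delta> * e / (P * w * V) * (P * d) = \<delta> * (e / V * d) / w" if "0 < w" "0 < P" "0 < V" for w P V e d :: real
        using that by (simp add: field_simps)
      from this[OF p1 V] show ?thesis unfolding \<theta>_def b_def .
    qed
    also have "\<dots> \<le> \<delta> * (?e / ?V * (C * ?n + 1 * ?n)) / (1 - p)"
      using \<delta> p1 V total_weight_nonneg \<eta> n
      by (intro divide_right_mono mult_left_mono add_mono mult_right_mono deg_le divide_nonneg_nonneg) auto
    also have "\<dots> = \<delta> * (C + 1) * (?e / ?V * ?n) / (1 - p)"
      by (simp only: distrib_right[symmetric]) (simp only: mult_ac)
    also have "\<dots> \<le> \<delta> * (C + 1) * C\<^sup>2 / (1 - p)"
      using \<delta> C_ge_1 p1 by (intro divide_right_mono mult_left_mono tilt_le) auto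
    also have "\<dots> \<le> \<delta> * (C + 1) * C\<^sup>2 / (1 / 2)"
      using \<delta> C_ge_1 p by (intro divide_left_mono) auto
    also have "\<dots> \<le> \<kappa>" using \<kappa> by (simp add: mult_ac)
    finally show "\<theta> * b i \<le> \<kappa>" .
    assume "i \<in> {1..N}"
    then show "bexp (\<lambda>_. p) N (\<lambda>B. partial_degree p i B ^ M) \<le> \<beta> i ^ M"
      unfolding \<beta>_def using p r_ge_2 u by (intro partial_degree_moment_le) auto
  qed (use \<sigma> p in auto)
  also have "- \<theta> * (\<delta> * p ^ k * ?e) + \<theta>\<^sup>2 * p * (1 - p) / 2 * exp \<kappa> * (\<Sum>i=1..N. (b i)\<^sup>2)
      \<le> - rate p \<delta> * (2 - exp \<kappa> * (1 + 3 * \<eta> * C\<^sup>2))"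
  proof -
    have "(\<Sum>i=1..N. (b i)\<^sup>2) \<le> (\<Sum>i=1..N. (p ^ (k - 1))\<^sup>2 * ((deg i)\<^sup>2 + 3 * \<eta> * C * ?n\<^sup>2))"
    proof (rule sum_mono)
      fix i
      \<comment> \<open>In units of \<open>(N ^ (r - 1))\<^sup>2\<close> the cross term is at most
        \<open>2 * \<eta> * C\<close> and, by \<open>\<eta> \<le> 1 \<le> C\<close>, the square at
        most \<open>\<eta> * C\<close>; hence the constant 3.\<close>
      have 1: "deg i * (2 * \<eta> * ?n) \<le> (C * ?n) * (2 * \<eta> * ?n)" using \<eta> n by (intro mult_right_mono deg_le) auto
      have "\<eta> * \<eta> \<le> C * \<eta>" using \<eta> C_ge_1 by (intro mult_right_mono) auto
      then have "\<eta> * \<eta> * (?n * ?n) \<le> C * \<eta> * (?n * ?n)" by (rule mult_right_mono) simp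
      with 1 have "deg i * (2 * \<eta> * ?n) + \<eta> * \<eta> * (?n * ?n) \<le> (C * ?n) * (2 * \<eta> * ?n) + C * \<eta> * (?n * ?n)"
        by (rule add_mono)
      then have "(deg i + \<eta> * ?n)\<^sup>2 \<le> (deg i)\<^sup>2 + 3 * \<eta> * C * ?n\<^sup>2"
        by (simp add: power2_eq_square algebra_simps)
      then show "(b i)\<^sup>2 \<le> (p ^ (k - 1))\<^sup>2 * ((deg i)\<^sup>2 + 3 * \<eta> * C * ?n\<^sup>2)"
        unfolding b_def power_mult_distrib by (intro mult_left_mono) auto
    qed
    also have "\<dots> = (p ^ (k - 1))\<^sup>2 * (?V + 3 * \<eta> * C\<^sup>2 * (real N * ?n\<^sup>2 / C))"
      unfolding degree_square_sum_def using C_ge_1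
      by (simp add: sum_distrib_left[symmetric] sum.distrib power2_eq_square[of C])
    also have "\<dots> \<le> (p ^ (k - 1))\<^sup>2 * (?V + 3 * \<eta> * C\<^sup>2 * ?V)"
      using \<eta> C_ge_1 degree_square_sum_ge by (intro mult_left_mono add_mono) auto
    finally have "\<theta>\<^sup>2 * p * (1 - p) / 2 * exp \<kappa> * (\<Sum>i=1..N. (b i)\<^sup>2)
      \<le> \<theta>\<^sup>2 * p * (1 - p) / 2 * exp \<kappa> * ((p ^ (k - 1))\<^sup>2 * (?V + 3 * \<eta> * C\<^sup>2 * ?V))"
      using p by (intro mult_left_mono) auto
    also have "\<dots> = (\<theta>\<^sup>2 * p * (1 - p) / 2 * (p ^ (k - 1))\<^sup>2 * ?V) * (exp \<kappa> * (1 + 3 * \<eta> * C\<^sup>2))"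
    proof -
      have "a / 2 * x * (P * (V + 3 * \<eta> * C\<^sup>2 * V)) = (a / 2 * P * V) * (x * (1 + 3 * \<eta> * C\<^sup>2))" for a x P V :: real
        by (simp add: algebra_simps)
      then show ?thesis .
    qed
    also have "\<theta>\<^sup>2 * p * (1 - p) / 2 * (p ^ (k - 1))\<^sup>2 * ?V = rate p \<delta>"
    proof -
      have "(\<delta> * e / (P * w * V))\<^sup>2 * p * w / 2 * P\<^sup>2 * V = \<delta>\<^sup>2 * p * e\<^sup>2 / (2 * w * V)"
        if "0 < w" "0 < P" "0 < V" for w P V e :: real
        using that by (simp add: power2_eq_square field_simps)
      from this[OF p1 V] show ?thesis unfolding \<theta>_def rate_eq .
    qed
    finally have "\<theta>\<^sup>2 * p * (1 - p) / 2 * exp \<kappa> * (\<Sum>i=1..N. (b i)\<^sup>2) \<le> rate p \<delta> * (exp \<kappa> * (1 + 3 * \<eta> * C\<^sup>2))" .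
    moreover have "\<theta> * (\<delta> * p ^ k * ?e) = 2 * rate p \<delta>"
    proof -
      have "\<delta> * e / (P * w * V) * (\<delta> * (p * P) * e) = 2 * (\<delta>\<^sup>2 * p * e\<^sup>2 / (2 * w * V))"
        if "0 < w" "0 < P" "0 < V" for w P V e :: real
        using that by (simp add: power2_eq_square field_simps)
      from this[OF p1 V] show ?thesis unfolding \<theta>_def rate_eq pk .
    qed
    ultimately show ?thesis by (simp add: algebra_simps)
  qed
  also have "(\<Sum>i=1..N. (\<beta> i / b i) ^ M) \<le> (\<Sum>i=1..N. exp (- (\<eta> / (2 * (C + 1)) * M)))"
  proof (rule sum_mono)
    fix i
    have d: "0 \<le> deg i" "deg i \<le> C * ?n" using set_degree_nonneg deg_le by auto
    have z: "0 \<le> ?z" using p by (intro add_nonneg_nonneg) auto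
    have "\<beta> i / b i = (deg i + C * ?n * ?z) / (deg i + \<eta> * ?n)"
      unfolding \<beta>_def b_def using p by simp
    \<comment> \<open>The numerator falls short of the denominator by at least
      \<open>\<eta> / 2 * N ^ (r - 1)\<close>, and the denominator is at most
      \<open>(C + 1) * N ^ (r - 1)\<close>.\<close>
    also have "\<dots> \<le> 1 - \<eta> / (2 * (C + 1))"
    proof -
      have "deg i + \<eta> * ?n \<le> C * ?n + 1 * ?n" using d \<eta> n by (intro add_mono mult_right_mono) auto
      then have "\<eta> / (2 * (C + 1)) * (deg i + \<eta> * ?n) \<le> \<eta> / (2 * (C + 1)) * ((C + 1) * ?n)"
        using \<eta> C_ge_1 by (intro mult_left_mono) (auto simp: algebra_simps)
      also have "\<dots> = \<eta> / 2 * ?n" using C_ge_1 by (simp add: field_simps)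
      finally have "\<eta> / (2 * (C + 1)) * (deg i + \<eta> * ?n) \<le> \<eta> / 2 * ?n" .
      moreover have "C * ?n * ?z \<le> \<eta> / 2 * ?n"
        using mult_right_mono[OF small, of ?n] n by (simp only: mult_ac)
      moreover have "A + B \<le> (1 - c) * (A + \<eta> * n)" if "c * (A + \<eta> * n) \<le> \<eta> / 2 * n" "B \<le> \<eta> / 2 * n" for A B c n :: real
        using that by (simp add: algebra_simps)
      ultimately have "deg i + C * ?n * ?z \<le> (1 - \<eta> / (2 * (C + 1))) * (deg i + \<eta> * ?n)"
        by blast
      moreover have "0 < deg i + \<eta> * ?n" using d \<eta> n by (intro add_nonneg_pos) auto
      ultimately show ?thesis by (simp add: pos_divide_le_eq)
    qed
    also have "\<dots> \<le> exp (- (\<eta> / (2 * (C + 1))))"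
      using exp_ge_add_one_self[of "- (\<eta> / (2 * (C + 1)))"] by simp
    finally have "\<beta> i / b i \<le> exp (- (\<eta> / (2 * (C + 1))))" .
    moreover have "0 \<le> \<beta> i / b i"
      unfolding \<beta>_def b_def using d z \<eta> p n C_ge_1
      by (intro divide_nonneg_nonneg mult_nonneg_nonneg add_nonneg_nonneg) auto
    ultimately have "(\<beta> i / b i) ^ M \<le> exp (- (\<eta> / (2 * (C + 1)))) ^ M" by (rule power_mono)
    then show "(\<beta> i / b i) ^ M \<le> exp (- (\<eta> / (2 * (C + 1)) * M))"
      by (simp add: exp_of_nat_mult[symmetric] mult.commute)
  qed
  finally show ?thesis by simp
qed

text \<open>By Cauchy-Schwarz the cheapest first-order shift of the mean is a tilt proportional to
  the degrees. The factor \<open>1 + \<eta>\<close> overshoots the target: half of the overshoot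
  covers the loss \<open>k * \<mu>\<close>, the other half is the margin for Chebyshev's
  inequality.\<close>

lemma moderate_tail_ge:
  fixes \<sigma> \<eta> \<delta> p v \<mu> l :: real
  assumes \<sigma>: "\<sigma> = 1 \<or> \<sigma> = -1" and p: "0 < p" "p < 1 / 2" and \<delta>: "0 < \<delta>" and \<eta>: "0 < \<eta>"
    and \<mu>: "\<mu> = (1 + \<eta>) * C ^ 3 * \<delta>" "\<mu> < 1" "(1 + \<eta>) * (k * \<mu>) \<le> \<eta> / 2" and kp: "real k \<le> p * N"
    and v: "v = 4 ^ (k + 1) * C ^ 3 * k / \<eta>\<^sup>2 * ((k * (k / (2 * p * N)) + (k / N) ^ r / (2 * p) ^ k) / \<delta>\<^sup>2)"
    and l: "0 \<le> l" "(1 + 2 * \<mu>) * ((1 + \<eta>)\<^sup>2 * rate p \<delta>) + ln 2 < l * (1 - v)"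
  shows "exp (- l) \<le> bexp (\<lambda>_. p) N (\<lambda>B. of_bool (\<delta> * p ^ k * total_weight H \<le> \<sigma> * deviation k p H B))"
proof -
  let ?n = "real N ^ (r - 1)" and ?V = degree_square_sum and ?e = "total_weight H"
  let ?z = "k * (k / (2 * p * N)) + (k / N) ^ r / (2 * p) ^ k"
  define m where "m x = (1 + \<eta>) * \<delta> * (?e / ?V) * deg x" for x
  note V = degree_square_sum_pos and e = total_weight_pos
  show ?thesis
  proof (rule deviation_tail_ge[OF \<sigma> p])
    fix x
    have m0: "0 \<le> m x" unfolding m_def using \<eta> \<delta> V total_weight_nonneg set_degree_nonneg by (intro mult_nonneg_nonneg divide_nonneg_nonneg) auto
    have "m x \<le> (1 + \<eta>) * \<delta> * (?e / ?V) * (C * ?n)"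
      unfolding m_def using \<eta> \<delta> V total_weight_nonneg by (intro mult_left_mono deg_le) auto
    also have "\<dots> = (1 + \<eta>) * \<delta> * C * (?e / ?V * ?n)" by (simp only: mult_ac)
    also have "\<dots> \<le> (1 + \<eta>) * \<delta> * C * C\<^sup>2" using \<eta> \<delta> C_ge_1 by (intro mult_left_mono tilt_le) auto
    also have "\<dots> = \<mu>" unfolding \<mu> by (simp add: power2_eq_square power3_eq_cube)
    finally show "0 \<le> m x \<and> m x \<le> \<mu>" using m0 by simp
  next
    show "0 < \<eta> / 2 * (\<delta> * p ^ k * ?e)" using \<eta> \<delta> p e by simp
  next
    have sum: "(\<Sum>x=1..N. deg x * m x) = (1 + \<eta>) * \<delta> * ?e"
    proof -
      have "(\<Sum>x=1..N. deg x * m x) = (1 + \<eta>) * \<delta> * (?e / ?V) * ?V"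
        unfolding m_def degree_square_sum_def sum_distrib_left by (simp add: power2_eq_square mult_ac)
      then show ?thesis using V by simp
    qed
    have "(1 + \<eta> / 2) * (\<delta> * p ^ k * ?e) \<le> ((1 - k * \<mu>) * (1 + \<eta>)) * (\<delta> * p ^ k * ?e)"
      using \<mu>(3) \<delta> p e by (intro mult_right_mono) (auto simp: algebra_simps)
    then show "\<delta> * p ^ k * ?e + \<eta> / 2 * (\<delta> * p ^ k * ?e) \<le> (1 - k * \<mu>) * p ^ k * (\<Sum>x=1..N. deg x * m x)"
      unfolding sum by (simp add: algebra_simps)
  next
    have z: "0 \<le> ?z" using p by (intro add_nonneg_nonneg) auto
    have "(2 * p) ^ k * ?e * (C * real N ^ r * (2 * p) ^ k * ?z)
        = (4 ^ k * (p ^ k)\<^sup>2 * ?e * C * ?z) * (real N * ?n)"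
    proof -
      have "(2 :: real) ^ k * 2 ^ k = 4 ^ k" by (simp flip: power_mult_distrib)
      then show ?thesis by (simp add: N_power(2) power_mult_distrib power2_eq_square mult_ac)
    qed
    \<comment> \<open>Trading \<open>N ^ r\<close> for a multiple of the total weight makes the
      variance bound a multiple of the squared margin.\<close>
    also have "\<dots> \<le> (4 ^ k * (p ^ k)\<^sup>2 * ?e * C * ?z) * (C\<^sup>2 * k * ?e)"
      using p C_ge_1 z total_weight_nonneg by (intro mult_left_mono total_weight_ge) auto
    also have "\<dots> = v * (\<eta> / 2 * (\<delta> * p ^ k * ?e))\<^sup>2"
    proof -
      have "(4 ^ k * (P)\<^sup>2 * e * C * z) * (C\<^sup>2 * k * e) = 4 ^ (k + 1) * C ^ 3 * k / \<eta>\<^sup>2 * (z / \<delta>\<^sup>2) * (\<eta> / 2 * (\<delta> * P * e))\<^sup>2" for P e z :: real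
        using \<eta> \<delta> by (simp add: power2_eq_square power3_eq_cube field_simps)
      then show ?thesis unfolding v .
    qed
    finally show "(2 * p) ^ k * ?e * (C * real N ^ r * (2 * p) ^ k * ?z) \<le> v * (\<eta> / 2 * (\<delta> * p ^ k * ?e))\<^sup>2" .
  next
    have "(\<Sum>x=1..N. (m x)\<^sup>2) = ((1 + \<eta>) * \<delta> * (?e / ?V))\<^sup>2 * ?V"
    proof -
      have "(\<Sum>x=1..N. (c * deg x)\<^sup>2) = c\<^sup>2 * ?V" for c
        unfolding degree_square_sum_def by (simp add: power_mult_distrib sum_distrib_left)
      then show ?thesis unfolding m_def .
    qed
    moreover have "p / (2 * w) * ((g * \<delta> * (e / V))\<^sup>2 * V) = g\<^sup>2 * (\<delta>\<^sup>2 * p * e\<^sup>2 / (2 * w * V))"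
      if "0 < w" "0 < V" for w g e V :: real
      using that by (simp add: power2_eq_square field_simps)
    from this[of "1 - p" ?V] have "p / (2 * (1 - p)) * (((1 + \<eta>) * \<delta> * (?e / ?V))\<^sup>2 * ?V) = (1 + \<eta>)\<^sup>2 * rate p \<delta>"
      unfolding rate_eq using p V by (simp only: diff_gt_0_iff_gt)
    ultimately have "p / (2 * (1 - p)) * (\<Sum>x=1..N. (m x)\<^sup>2) = (1 + \<eta>)\<^sup>2 * rate p \<delta>"
      by (simp only:)
    then show "(1 + 2 * \<mu>) * (p / (2 * (1 - p)) * (\<Sum>x=1..N. (m x)\<^sup>2)) + ln 2 < l * (1 - v)"
      using l by simp
  qed (use \<mu> kp l in auto)
qed

end

section \<open>Asymptotics\<close>

text \<open>The error term is obtained by solving the asserted equation for it; the bounds for every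
  fixed error squeeze it to 0.\<close>

lemma exp_rate_of_bounds:
  fixes P I :: "nat \<Rightarrow> real"
  assumes I: "\<forall>\<^sub>F N in sequentially. 0 < I N"
    and upper: "\<And>\<epsilon>. 0 < \<epsilon> \<Longrightarrow> \<epsilon> \<le> 1 \<Longrightarrow> \<forall>\<^sub>F N in sequentially. P N \<le> exp (- (1 - \<epsilon>) * I N)"
    and lower: "\<And>\<epsilon>. 0 < \<epsilon> \<Longrightarrow> \<epsilon> \<le> 1 \<Longrightarrow> \<forall>\<^sub>F N in sequentially. exp (- (1 + \<epsilon>) * I N) \<le> P N"
  shows "\<exists>\<epsilon>. \<epsilon> \<longlonglongrightarrow> 0 \<and> (\<forall>\<^sub>F N in sequentially. P N = exp (- (1 + \<epsilon> N) * I N))"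
proof -
  define \<epsilon> where "\<epsilon> N = - ln (P N) / I N - 1" for N
  have "\<epsilon> \<longlonglongrightarrow> 0"
  proof (rule tendstoI)
    fix e :: real assume e: "0 < e"
    define e' where "e' = min 1 (e / 2)"
    have e': "0 < e'" "e' \<le> 1" "e' < e" using e by (auto simp: e'_def)
    show "\<forall>\<^sub>F N in sequentially. dist (\<epsilon> N) 0 < e"
      using I upper[OF e'(1,2)] lower[OF e'(1,2)]
    proof eventually_elim
      case (elim N)
      have P: "0 < P N" using elim(3) exp_gt_zero[of "- (1 + e') * I N"] by linarith
      have "ln (P N) \<le> - (1 - e') * I N" "- (1 + e') * I N \<le> ln (P N)"
        using P elim(2,3) ln_le_cancel_iff[OF P exp_gt_zero, of "- (1 - e') * I N"] by (simp_all only: ln_ge_iff ln_exp)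
      then have "(1 - e') * I N \<le> - ln (P N)" "- ln (P N) \<le> (1 + e') * I N"
        by (simp_all add: algebra_simps)
      then have "1 - e' \<le> - ln (P N) / I N" "- ln (P N) / I N \<le> 1 + e'"
        using elim(1) by (simp_all only: pos_le_divide_eq pos_divide_le_eq)
      then have "\<bar>\<epsilon> N\<bar> \<le> e'" unfolding \<epsilon>_def by linarith
      then show ?case using e' by simp
    qed
  qed
  \<comment> \<open>The lower bound at error 1 makes \<open>P N\<close> positive, so that
    \<open>exp\<close> undoes \<open>ln\<close>.\<close>
  moreover have "\<forall>\<^sub>F N in sequentially. P N = exp (- (1 + \<epsilon> N) * I N)"
    using I lower[of 1, simplified]
  proof eventually_elim
    case (elim N)
    have P: "0 < P N" using elim(2) exp_gt_zero[of "- (2 * I N)"] by linarith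
    then show ?case using elim(1) by (simp add: \<epsilon>_def)
  qed
  ultimately show ?thesis by blast
qed

text \<open>The hypotheses on \<open>\<delta>\<close> in the form in which they are applied:
  \<open>speed\<close> and \<open>speed_ln\<close> come from its lower bound,
  \<open>\<delta>_tendsto\<close> and \<open>cluster\<close> from its upper bound.\<close>

locale moderate_regime =
  fixes H :: "nat \<Rightarrow> weighted_hypergraph" and p \<delta> :: "nat \<Rightarrow> real" and k r :: nat and C :: real
  assumes r_ge_2: "2 \<le> r" and r_le_k: "r \<le> k" and C_ge_1: "1 \<le> C"
    and regular: "\<forall>\<^sub>F N in sequentially. high_degree_variance (H N) k r N C"
    and p: "\<forall>\<^sub>F N in sequentially. 0 < p N \<and> p N < 1 / 2"
    and \<delta>_pos: "\<forall>\<^sub>F N in sequentially. 0 < \<delta> N"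
    and \<delta>_tendsto: "\<delta> \<longlonglongrightarrow> 0"
    and speed: "filterlim (\<lambda>N. (\<delta> N)\<^sup>2 * p N * real N) at_top sequentially"
    and speed_ln: "(\<lambda>N. ln (real N) / ((\<delta> N)\<^sup>2 * p N * real N)) \<longlonglongrightarrow> 0"
    and cluster: "(\<lambda>N. ((\<delta> N)\<^sup>2 * p N) ^ (r - 1) / p N ^ (k - 1)) \<longlonglongrightarrow> 0"
begin

abbreviation s :: "nat \<Rightarrow> real" where "s N \<equiv> (\<delta> N)\<^sup>2 * p N * real N"

abbreviation I :: "nat \<Rightarrow> real" where "I N \<equiv> gaussian_rate N (H N) (p N) (\<delta> N)"

abbreviation tail :: "real \<Rightarrow> nat \<Rightarrow> real" where
  "tail \<sigma> N \<equiv> bexp (\<lambda>_. p N) N (\<lambda>B. of_bool (\<delta> N * p N ^ k * total_weight (H N) \<le> \<sigma> * deviation k (p N) (H N) B))"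

lemma rate_tendsto: "filterlim I at_top sequentially"
proof -
  have c: "0 < 2 * C ^ 4 * (real k)\<^sup>2" using C_ge_1 r_ge_2 r_le_k by simp
  have "filterlim (\<lambda>N. 1 / (2 * C ^ 4 * (real k)\<^sup>2) * s N) at_top sequentially"
    using c by (intro filterlim_tendsto_pos_mult_at_top[OF tendsto_const _ speed]) auto
  then show ?thesis
  proof (rule filterlim_at_top_mono)
    show "\<forall>\<^sub>F N in sequentially. 1 / (2 * C ^ 4 * (real k)\<^sup>2) * s N \<le> I N"
      using regular p
    proof eventually_elim
      case (elim N)
      then interpret high_degree_variance "H N" k r N C by simp
      from rate_ge[of "p N" "\<delta> N"] elim(2) c show ?case by (simp add: pos_divide_le_eq mult_ac)
    qed
  qed
qed

lemma rate_pos: "\<forall>\<^sub>F N in sequentially. 0 < I N"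
  using rate_tendsto by (simp add: filterlim_at_top_dense)

lemma eventually_tail_le:
  assumes \<sigma>: "\<sigma> = 1 \<or> \<sigma> = -1" and \<epsilon>: "0 < \<epsilon>" "\<epsilon> \<le> 1"
  shows "\<forall>\<^sub>F N in sequentially. tail \<sigma> N \<le> exp (- (1 - \<epsilon>) * I N)"
proof -
  \<comment> \<open>\<open>\<eta>\<close> and \<open>\<kappa>\<close> make
    \<open>exp \<kappa> * (1 + 3 * \<eta> * C\<^sup>2)\<close> exactly
    \<open>(1 + \<epsilon> / 8)\<^sup>2\<close>.\<close>
  define \<eta> where "\<eta> = \<epsilon> / (24 * C\<^sup>2)"
  define \<kappa> where "\<kappa> = ln (1 + \<epsilon> / 8)"
  \<comment> \<open>This makes \<open>\<eta> / (2 * (C + 1)) * M N\<close> at least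
    \<open>(C ^ 3 + 1) * s N\<close>: by \<open>rate_le\<close> the part \<open>C ^ 3 * s N\<close>
    covers the rate, and the remaining \<open>s N\<close> covers \<open>ln N\<close> from the union
    bound.\<close>
  define K where "K = 2 * (C + 1) / \<eta> * (C ^ 3 + 1)"
  \<comment> \<open>Rounding \<open>K * s N\<close> up at most doubles it once it is at least 1, so
    \<open>u N \<le> b * s N\<close>.\<close>
  define b where "b = real k * (2 * K)"
  define M where "M N = nat \<lceil>K * s N\<rceil>" for N
  define u where "u N = (k - 1) * M N" for N
  have C2: "1 \<le> C\<^sup>2" using C_ge_1 by simp
  have "\<epsilon> \<le> 24 * C\<^sup>2" using \<epsilon> C2 by linarith
  then have \<eta>: "0 < \<eta>" "\<eta> \<le> 1" using \<epsilon> C_ge_1 by (simp_all add: \<eta>_def pos_divide_le_eq)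
  have \<kappa>: "0 < \<kappa>" using \<epsilon> by (simp add: \<kappa>_def)
  have K: "0 < K" unfolding K_def using \<eta> C_ge_1 by (intro mult_pos_pos divide_pos_pos add_nonneg_pos) auto
  have b: "0 < b" using K r_ge_2 r_le_k by (simp add: b_def)
  have exponent: "1 - \<epsilon> / 2 \<le> 2 - exp \<kappa> * (1 + 3 * \<eta> * C\<^sup>2)"
  proof -
    have "exp \<kappa> * (1 + 3 * \<eta> * C\<^sup>2) = (1 + \<epsilon> / 8) * (1 + \<epsilon> / 8)"
      using \<epsilon> C2 C_ge_1 by (simp add: \<kappa>_def \<eta>_def)
    also have "\<dots> = 1 + \<epsilon> / 4 + \<epsilon> * \<epsilon> / 64" by (simp add: field_simps)
    also have "\<dots> \<le> 1 + \<epsilon> / 2" using mult_left_mono[OF \<epsilon>(2), of \<epsilon>] \<epsilon> by linarith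
    finally show ?thesis by simp
  qed
  have ev_\<kappa>: "\<forall>\<^sub>F N in sequentially. 2 * C\<^sup>2 * (C + 1) * \<delta> N < \<kappa>"
  proof -
    have "(\<lambda>N. 2 * C\<^sup>2 * (C + 1) * \<delta> N) \<longlonglongrightarrow> 2 * C\<^sup>2 * (C + 1) * 0" by (intro tendsto_intros \<delta>_tendsto)
    then show ?thesis by (rule order_tendstoD(2)) (use \<kappa> in simp)
  qed
  have ev_b: "\<forall>\<^sub>F N in sequentially. b * (\<delta> N)\<^sup>2 < 1"
  proof -
    have "(\<lambda>N. b * (\<delta> N)\<^sup>2) \<longlonglongrightarrow> b * 0\<^sup>2" by (intro tendsto_intros \<delta>_tendsto)
    then show ?thesis by (rule order_tendstoD(2)) simp
  qed
  have ev_small: "\<forall>\<^sub>F N in sequentially. C * (k * (b * (\<delta> N)\<^sup>2) + b ^ (r - 1) * (((\<delta> N)\<^sup>2 * p N) ^ (r - 1) / p N ^ (k - 1))) < \<eta> / 2"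
  proof -
    have "(\<lambda>N. C * (k * (b * (\<delta> N)\<^sup>2) + b ^ (r - 1) * (((\<delta> N)\<^sup>2 * p N) ^ (r - 1) / p N ^ (k - 1))))
      \<longlonglongrightarrow> C * (k * (b * 0\<^sup>2) + b ^ (r - 1) * 0)"
      by (intro tendsto_intros \<delta>_tendsto cluster)
    then show ?thesis by (rule order_tendstoD(2)) (use \<eta> in simp)
  qed
  have ev_s: "\<forall>\<^sub>F N in sequentially. max (1 / K) 1 \<le> s N"
    using speed unfolding filterlim_at_top by blast
  have ev_ln: "\<forall>\<^sub>F N in sequentially. ln (real N) / s N < 1"
    using speed_ln by (intro order_tendstoD) auto
  \<comment> \<open>The two summands of the bound are each estimated with error
    \<open>\<epsilon> / 2\<close>; the other \<open>\<epsilon> / 2\<close> absorbs the factor 2 of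
    their sum.\<close>
  have ev_I: "\<forall>\<^sub>F N in sequentially. 2 * ln 2 / \<epsilon> \<le> I N"
    using rate_tendsto by (simp add: filterlim_at_top)
  show ?thesis
    using regular p \<delta>_pos ev_\<kappa> ev_b ev_small ev_s ev_ln ev_I
  proof eventually_elim
    case (elim N)
    then interpret high_degree_variance "H N" k r N C by simp
    have p: "0 < p N" "p N < 1 / 2" and N: "0 < real N" using elim N_pos by auto
    have s: "0 < s N" "1 \<le> K * s N" using elim(7) K by (auto simp: field_simps)
    have M: "K * s N \<le> real (M N)" "real (M N) \<le> 2 * K * s N"
      using s(2) by (auto simp: M_def) linarith+
    have u: "real (u N) \<le> b * s N"
    proof -
      have "real (u N) \<le> real k * real (M N)" unfolding u_def of_nat_mult by (intro mult_right_mono) auto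
      also have "\<dots> \<le> real k * (2 * K * s N)" using M by (intro mult_left_mono) auto
      finally show ?thesis by (simp add: b_def mult_ac)
    qed
    have upN: "u N / (p N * N) \<le> b * (\<delta> N)\<^sup>2" and uN: "u N / N \<le> b * ((\<delta> N)\<^sup>2 * p N)"
      using u p N by (simp_all add: pos_divide_le_eq mult_ac)
    have "b * s N \<le> 1 * (p N * N)"
      using mult_right_mono[of "b * (\<delta> N)\<^sup>2" 1 "p N * N"] elim(5) p by (simp add: mult_ac)
    with u have "real (u N) \<le> p N * N" by simp
    moreover have "C * (k * (u N / (p N * N)) + (u N / N) ^ (r - 1) / p N ^ (k - 1)) \<le> \<eta> / 2"
    proof -
      have "(u N / N) ^ (r - 1) / p N ^ (k - 1) \<le> (b * ((\<delta> N)\<^sup>2 * p N)) ^ (r - 1) / p N ^ (k - 1)"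
        using p by (intro divide_right_mono power_mono uN) auto
      then have "C * (k * (u N / (p N * N)) + (u N / N) ^ (r - 1) / p N ^ (k - 1))
        \<le> C * (k * (b * (\<delta> N)\<^sup>2) + b ^ (r - 1) * (((\<delta> N)\<^sup>2 * p N) ^ (r - 1) / p N ^ (k - 1)))"
        using C_nonneg upN by (intro mult_left_mono add_mono) (auto simp: power_mult_distrib)
      then show ?thesis using elim(6) by linarith
    qed
    ultimately have "tail \<sigma> N \<le> exp (- I N * (2 - exp \<kappa> * (1 + 3 * \<eta> * C\<^sup>2))) + N * exp (- (\<eta> / (2 * (C + 1)) * M N))"
      using elim(3,4) p \<eta> \<sigma> by (intro moderate_tail_le[where u = "u N"]) (auto simp: u_def)
    also have "exp (- I N * (2 - exp \<kappa> * (1 + 3 * \<eta> * C\<^sup>2))) \<le> exp (- (1 - \<epsilon> / 2) * I N)"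
      using mult_left_mono[OF exponent, of "I N"] rate_pos[OF elim(3) p]
      by (simp only: exp_le_cancel_iff mult_minus_left neg_le_iff_le mult.commute[of "1 - \<epsilon> / 2"] less_imp_le)
    also have "N * exp (- (\<eta> / (2 * (C + 1)) * M N)) \<le> exp (- (1 - \<epsilon> / 2) * I N)"
    proof -
      have "(C ^ 3 + 1) * s N = \<eta> / (2 * (C + 1)) * (K * s N)"
        unfolding K_def using \<eta> C_ge_1 by simp
      also have "\<dots> \<le> \<eta> / (2 * (C + 1)) * M N" using M \<eta> C_ge_1 by (intro mult_left_mono) auto
      finally have 1: "(C ^ 3 + 1) * s N \<le> \<eta> / (2 * (C + 1)) * M N" .
      have 2: "ln (real N) \<le> s N" using elim(8) s by (simp add: pos_divide_less_eq)
      have 3: "(1 - \<epsilon> / 2) * I N \<le> 1 * I N" using rate_pos[OF elim(3) p] \<epsilon> by (intro mult_right_mono) auto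
      have "N * exp (- (\<eta> / (2 * (C + 1)) * M N)) = exp (ln (real N) - \<eta> / (2 * (C + 1)) * M N)"
        using N by (simp add: exp_diff exp_minus divide_inverse)
      also have "\<dots> \<le> exp (- (1 - \<epsilon> / 2) * I N)"
        using 1 2 3 rate_le[OF p, of "\<delta> N"]
        unfolding exp_le_cancel_iff mult_minus_left distrib_right by linarith
      finally show ?thesis .
    qed
    also have "exp (- (1 - \<epsilon> / 2) * I N) + exp (- (1 - \<epsilon> / 2) * I N) = exp (ln 2 + - (1 - \<epsilon> / 2) * I N)"
      by (simp add: exp_add)
    also have "\<dots> \<le> exp (- (1 - \<epsilon>) * I N)"
      using elim(9) \<epsilon> by (simp add: field_simps)
    finally show ?case by simp
  qed
qed

lemma eventually_tail_ge:
  assumes \<sigma>: "\<sigma> = 1 \<or> \<sigma> = -1" and \<epsilon>: "0 < \<epsilon>" "\<epsilon> \<le> 1"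
  shows "\<forall>\<^sub>F N in sequentially. exp (- (1 + \<epsilon>) * I N) \<le> tail \<sigma> N"
proof -
  \<comment> \<open>\<open>\<epsilon> = 16 * \<eta>\<close> leaves room for all losses:
    \<open>(1 + \<eta>)\<^sup>2\<close> from the overshoot, \<open>1 + \<eta>\<close> from
    \<open>\<mu>\<close>, \<open>\<eta>\<close> times the rate from \<open>ln 2\<close>, and
    \<open>1 - \<eta>\<close> from \<open>v\<close>.\<close>
  define \<eta> where "\<eta> = \<epsilon> / 16"
  define \<mu> where "\<mu> N = (1 + \<eta>) * C ^ 3 * \<delta> N" for N
  define v where "v N = 4 ^ (k + 1) * C ^ 3 * k / \<eta>\<^sup>2 *
    ((k * (k / (2 * p N * N)) + (k / N) ^ r / (2 * p N) ^ k) / (\<delta> N)\<^sup>2)" for N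
  have \<eta>: "0 < \<eta>" "\<eta> \<le> 1 / 16" using \<epsilon> by (auto simp: \<eta>_def)
  have \<mu>_tendsto: "\<mu> \<longlonglongrightarrow> 0"
  proof -
    have "\<mu> \<longlonglongrightarrow> (1 + \<eta>) * C ^ 3 * 0" unfolding \<mu>_def by (intro tendsto_intros \<delta>_tendsto)
    then show ?thesis by simp
  qed
  have inv_s: "(\<lambda>N. inverse (s N)) \<longlonglongrightarrow> 0"
    by (rule tendsto_inverse_0_at_top[OF speed])
  have ev_s: "\<forall>\<^sub>F N in sequentially. 0 < s N" using speed by (simp add: filterlim_at_top_dense)
  have v_tendsto: "v \<longlonglongrightarrow> 0"
  proof -
    let ?c = "4 ^ (k + 1) * C ^ 3 * k / \<eta>\<^sup>2"
    \<comment> \<open>\<open>v\<close> in terms of quantities with known limits: up to constants,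
      the second term is the sequence of \<open>cluster\<close> times the \<open>r\<close>-th power
      of \<open>inverse (s N)\<close>.\<close>
    let ?w = "\<lambda>N. ?c * ((real k)\<^sup>2 / 2 * inverse (s N) + real k ^ r / 2 ^ k * (((\<delta> N)\<^sup>2 * p N) ^ (r - 1) / p N ^ (k - 1)) * inverse (s N) ^ r)"
    have "?w \<longlonglongrightarrow> ?c * ((real k)\<^sup>2 / 2 * 0 + real k ^ r / 2 ^ k * 0 * 0 ^ r)"
      by (intro tendsto_intros inv_s cluster)
    moreover have "\<forall>\<^sub>F N in sequentially. ?w N = v N"
      using p \<delta>_pos eventually_gt_at_top[of 0]
    proof eventually_elim
      case (elim N)
      obtain r' k' where rk: "r = Suc r'" "k = Suc k'" using r_ge_2 r_le_k by (cases r; cases k) auto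
      have pos: "0 < p N" "0 < \<delta> N" "0 < real N" using elim by auto
      have 1: "(real k)\<^sup>2 / 2 * inverse (s N) = k * (k / (2 * p N * N)) / (\<delta> N)\<^sup>2"
        using pos by (simp add: power2_eq_square field_simps)
      have 2: "c / 2 ^ k * (x ^ r' / p N ^ k') * inverse (x * real N) ^ r = c / real N ^ r / (2 * p N) ^ k * (p N / x)"
        if "0 < x" for c x :: real
      proof -
        have "inverse (x * real N) ^ r = inverse (real N) ^ r * inverse x * inverse (x ^ r')"
          unfolding rk by (simp add: power_inverse power_mult_distrib)
        then have "x ^ r' * inverse (x * real N) ^ r = inverse (real N) ^ r * inverse x" using that by simp
        then have "c / 2 ^ k * (x ^ r' / p N ^ k') * inverse (x * real N) ^ r = c / 2 ^ k / p N ^ k' * (inverse (real N) ^ r * inverse x)"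
          by (simp only: mult.assoc times_divide_eq_left times_divide_eq_right)
        also have "\<dots> = c / real N ^ r / (2 ^ k * (p N * p N ^ k')) * (p N / x)"
          using pos(1) by (simp add: divide_inverse power_inverse)
        also have "2 ^ k * (p N * p N ^ k') = (2 * p N) ^ k" unfolding rk by (simp add: power_mult_distrib)
        finally show ?thesis .
      qed
      have "(real k)\<^sup>2 / 2 * inverse (s N) + real k ^ r / 2 ^ k * (((\<delta> N)\<^sup>2 * p N) ^ (r - 1) / p N ^ (k - 1)) * inverse (s N) ^ r
         = (k * (k / (2 * p N * N)) + (k / N) ^ r / (2 * p N) ^ k) / (\<delta> N)\<^sup>2"
        using 1 2[of "(\<delta> N)\<^sup>2 * p N" "real k ^ r"] pos unfolding add_divide_distrib power_divide
        by (simp add: rk)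
      then show ?case unfolding v_def by (simp only:)
    qed
    ultimately show ?thesis by (simp add: tendsto_cong)
  qed
  have ev_\<mu>: "\<forall>\<^sub>F N in sequentially. \<mu> N < \<eta> / 2" using \<mu>_tendsto \<eta> by (intro order_tendstoD) auto
  have ev_k\<mu>: "\<forall>\<^sub>F N in sequentially. (1 + \<eta>) * (k * \<mu> N) < \<eta> / 2"
  proof -
    have "(\<lambda>N. (1 + \<eta>) * (k * \<mu> N)) \<longlonglongrightarrow> (1 + \<eta>) * (real k * (0 :: real))" by (intro tendsto_intros \<mu>_tendsto)
    then show ?thesis by (rule order_tendstoD(2)) (use \<eta> in simp)
  qed
  have ev_v: "\<forall>\<^sub>F N in sequentially. v N < \<eta>" using v_tendsto \<eta> by (intro order_tendstoD) auto
  have ev_\<delta>: "\<forall>\<^sub>F N in sequentially. \<delta> N < 1" using \<delta>_tendsto by (intro order_tendstoD) auto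
  have ev_k: "\<forall>\<^sub>F N in sequentially. real k \<le> s N" using speed by (simp add: filterlim_at_top)
  have ev_I: "\<forall>\<^sub>F N in sequentially. ln 2 / \<eta> \<le> I N" using rate_tendsto by (simp add: filterlim_at_top)
  show ?thesis
    using regular p \<delta>_pos ev_\<mu> ev_k\<mu> ev_v ev_\<delta> ev_k ev_I
  proof eventually_elim
    case (elim N)
    then interpret high_degree_variance "H N" k r N C by simp
    have p: "0 < p N" "p N < 1 / 2" using elim by auto
    have I: "0 < I N" using rate_pos[OF elim(3) p] .
    have \<mu>0: "0 \<le> \<mu> N" using elim(3) \<eta> C_ge_1 by (simp add: \<mu>_def)
    have "exp (- ((1 + \<epsilon>) * I N)) \<le> tail \<sigma> N"
    proof (rule moderate_tail_ge[OF \<sigma> p elim(3) \<eta>(1) \<mu>_def _ _ _ v_def])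
      show "\<mu> N < 1" "(1 + \<eta>) * (real k * \<mu> N) \<le> \<eta> / 2" using elim \<eta> by auto
      \<comment> \<open>As \<open>\<delta> N < 1\<close>, \<open>p N * N\<close> is at least
        \<open>s N\<close>, which is eventually at least \<open>k\<close>.\<close>
      have "(\<delta> N)\<^sup>2 \<le> 1" using elim(3,7) by (simp add: power_le_one)
      then have "(\<delta> N)\<^sup>2 * (p N * N) \<le> 1 * (p N * N)" using p by (intro mult_right_mono) auto
      then show "real k \<le> p N * N" using elim(8) by (simp add: mult.assoc)
      show "0 \<le> (1 + \<epsilon>) * I N" using I \<epsilon> by simp
      have "(1 + 2 * \<mu> N) * ((1 + \<eta>)\<^sup>2 * I N) + ln 2 \<le> (1 + \<eta>) * ((1 + \<eta>)\<^sup>2 * I N) + \<eta> * I N"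
        using elim(4,9) I \<eta> by (intro add_mono mult_right_mono) (auto simp: field_simps)
      also have "\<dots> = ((1 + \<eta>) * (1 + \<eta>)\<^sup>2 + \<eta>) * I N" by (simp add: algebra_simps)
      also have "\<dots> < ((1 + \<epsilon>) * (1 - \<eta>)) * I N"
      proof (intro mult_strict_right_mono I)
        have "\<eta> * \<eta> \<le> 1 / 16 * \<eta>" using \<eta> by (intro mult_right_mono) auto
        moreover have "\<eta> * \<eta> * \<eta> \<le> 1 * \<eta>" using \<eta> mult_mono[of \<eta> 1 \<eta> 1] by (intro mult_right_mono) auto
        moreover have "(1 + \<eta>) * (1 + \<eta>)\<^sup>2 + \<eta> = 1 + 4 * \<eta> + 3 * (\<eta> * \<eta>) + \<eta> * \<eta> * \<eta>"
          by (simp add: power2_eq_square algebra_simps)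
        moreover have "(1 + \<epsilon>) * (1 - \<eta>) = 1 + 15 * \<eta> - 16 * (\<eta> * \<eta>)"
          by (simp add: \<eta>_def field_simps)
        ultimately show "(1 + \<eta>) * (1 + \<eta>)\<^sup>2 + \<eta> < (1 + \<epsilon>) * (1 - \<eta>)" using \<eta> by linarith
      qed
      also have "\<dots> = (1 + \<epsilon>) * I N * (1 - \<eta>)" by (simp only: mult_ac)
      also have "\<dots> \<le> (1 + \<epsilon>) * I N * (1 - v N)" using elim(6) I \<epsilon> by (intro mult_left_mono) auto
      finally show "(1 + 2 * \<mu> N) * ((1 + \<eta>)\<^sup>2 * I N) + ln 2 < (1 + \<epsilon>) * I N * (1 - v N)" .
    qed
    then show ?case by (simp only: mult_minus_left)
  qed
qed

lemma tail_asymptotics: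
  assumes \<sigma>: "\<sigma> = 1 \<or> \<sigma> = -1"
  shows "\<exists>\<epsilon>. \<epsilon> \<longlonglongrightarrow> 0 \<and> (\<forall>\<^sub>F N in sequentially. 
    measure_pmf.prob (random_subset N (p N)) {B. \<delta> N * p N ^ k * total_weight (H N) \<le> \<sigma> * deviation k (p N) (H N) B}
      = exp (- (1 + \<epsilon> N) * I N))"
proof -
  obtain \<epsilon> where \<epsilon>: "\<epsilon> \<longlonglongrightarrow> 0" "\<forall>\<^sub>F N in sequentially. tail \<sigma> N = exp (- (1 + \<epsilon> N) * I N)"
    using exp_rate_of_bounds[OF rate_pos eventually_tail_le[OF \<sigma>] eventually_tail_ge[OF \<sigma>]] by auto
  have "\<forall>\<^sub>F N in sequentially. 
    measure_pmf.prob (random_subset N (p N)) {B. \<delta> N * p N ^ k * total_weight (H N) \<le> \<sigma> * deviation k (p N) (H N) B}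
      = exp (- (1 + \<epsilon> N) * I N)"
    using \<epsilon>(2) p by eventually_elim (simp add: prob_random_subset)
  with \<epsilon>(1) show ?thesis by blast
qed

end

section \<open>Translation of the hypotheses into the moderate regime\<close>

theorem theorem1p1:
  fixes k r C :: nat
    and H :: "nat \<Rightarrow> weighted_hypergraph"
    and p \<delta> :: "nat \<Rightarrow> real"
  assumes "2 \<le> r" and "r \<le> k" and "1 \<le> C"
    and "\<forall>\<^sub>F N in sequentially. uniform_on k N (H N)"
    and "\<forall>\<^sub>F N in sequentially. max_degree r N (H N) \<le> real C"
    and "\<forall>\<^sub>F N in sequentially. degree_variance N (H N) \<ge> real N ^ (2 * r - 2) / real C"
    and "\<forall>\<^sub>F N in sequentially. 0 < p N \<and> p N < 1 / 2"
    and "(\<exists>c. \<forall>\<^sub>F N in sequentially. p N = c) \<or> p \<longlonglongrightarrow> 0"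
    and "\<forall>\<^sub>F N in sequentially. 0 < \<delta> N"
    and "much_smaller (\<lambda>N. sqrt (ln (real N) / (p N * real N))) \<delta>"
    and "much_smaller \<delta> (\<lambda>N. p N powr ((real k - real r) / (2 * (real r - 1))))"
  shows
    "(\<exists>\<epsilon>. \<epsilon> \<longlonglongrightarrow> 0 \<and>
       (\<forall>\<^sub>F N in sequentially.
          measure_pmf.prob (random_subset N (p N))
            {B. deviation k (p N) (H N) B \<ge> \<delta> N * p N ^ k * total_weight (H N)}
          = exp (- (1 + \<epsilon> N) * (\<delta> N)\<^sup>2 * p N * (total_weight (H N))\<^sup>2
                 / (2 * (1 - p N) * ((avg_degree N (H N))\<^sup>2 + degree_variance N (H N)) * real N))))
     \<and>
     (\<exists>\<epsilon>. \<epsilon> \<longlonglongrightarrow> 0 \<and>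
       (\<forall>\<^sub>F N in sequentially.
          measure_pmf.prob (random_subset N (p N))
            {B. deviation k (p N) (H N) B \<le> - \<delta> N * p N ^ k * total_weight (H N)}
          = exp (- (1 + \<epsilon> N) * (\<delta> N)\<^sup>2 * p N * (total_weight (H N))\<^sup>2
                 / (2 * (1 - p N) * ((avg_degree N (H N))\<^sup>2 + degree_variance N (H N)) * real N))))"
proof -
  define \<alpha> where "\<alpha> = (real k - real r) / (2 * (real r - 1))"
  have \<alpha>: "0 \<le> \<alpha>" using assms(1,2) by (simp add: \<alpha>_def)
  note p = assms(7) and \<delta>_pos = assms(9)
  have ratio: "(\<lambda>N. \<delta> N / p N powr \<alpha>) \<longlonglongrightarrow> 0"
    using assms(11) by (simp add: much_smaller_def \<alpha>_def)
  \<comment> \<open>As \<open>p N < 1\<close> and \<open>\<alpha> \<ge> 0\<close>, dividing by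
    \<open>p N powr \<alpha>\<close> only enlarges \<open>\<delta> N\<close>.\<close>
  have \<delta>_tendsto: "\<delta> \<longlonglongrightarrow> 0"
  proof (rule tendsto_sandwich[OF _ _ tendsto_const ratio])
    show "\<forall>\<^sub>F N in sequentially. \<delta> N \<le> \<delta> N / p N powr \<alpha>"
      using p \<delta>_pos
    proof eventually_elim
      case (elim N)
      have "p N powr \<alpha> \<le> 1" using elim \<alpha> by (intro powr_le1) auto
      then have "\<delta> N * p N powr \<alpha> \<le> \<delta> N * 1" using elim by (intro mult_left_mono) auto
      then show ?case using elim by (simp add: pos_le_divide_eq)
    qed
  qed (use \<delta>_pos in \<open>auto elim: eventually_mono\<close>)
  have speed_ln: "(\<lambda>N. ln (real N) / ((\<delta> N)\<^sup>2 * p N * real N)) \<longlonglongrightarrow> 0"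
  proof -
    have "(\<lambda>N. (sqrt (ln (real N) / (p N * real N)) / \<delta> N)\<^sup>2) \<longlonglongrightarrow> 0\<^sup>2"
      using assms(10) unfolding much_smaller_def by (rule tendsto_power)
    moreover have "\<forall>\<^sub>F N in sequentially. (sqrt (ln (real N) / (p N * real N)) / \<delta> N)\<^sup>2 = ln (real N) / ((\<delta> N)\<^sup>2 * p N * real N)"
      using p \<delta>_pos eventually_ge_at_top[of 1]
    proof eventually_elim
      case (elim N)
      then have "0 \<le> ln (real N) / (p N * real N)" by (intro divide_nonneg_nonneg) auto
      then show ?case by (simp add: power_divide mult_ac)
    qed
    ultimately show ?thesis by (simp add: tendsto_cong)
  qed
  have speed: "filterlim (\<lambda>N. (\<delta> N)\<^sup>2 * p N * real N) at_top sequentially"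
  proof (rule filterlim_at_top_mono)
    show "filterlim (\<lambda>N. ln (real N)) at_top sequentially"
      by (rule filterlim_compose[OF ln_at_top filterlim_real_sequentially])
    have "\<forall>\<^sub>F N in sequentially. ln (real N) / ((\<delta> N)\<^sup>2 * p N * real N) < 1"
      using speed_ln by (intro order_tendstoD) auto
    then show "\<forall>\<^sub>F N in sequentially. ln (real N) \<le> (\<delta> N)\<^sup>2 * p N * real N"
      using p \<delta>_pos eventually_gt_at_top[of 0]
      by eventually_elim (simp add: pos_divide_less_eq)
  qed
  \<comment> \<open>This is \<open>ratio\<close> raised to the power \<open>2 * (r - 1)\<close>: the
    denominator becomes \<open>p N ^ (k - r)\<close>, and expanding the fraction by
    \<open>p N ^ (r - 1)\<close> gives the stated form.\<close>
  have cluster: "(\<lambda>N. ((\<delta> N)\<^sup>2 * p N) ^ (r - 1) / p N ^ (k - 1)) \<longlonglongrightarrow> 0"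
  proof -
    have "(\<lambda>N. (\<delta> N / p N powr \<alpha>) ^ (2 * (r - 1))) \<longlonglongrightarrow> 0"
      using tendsto_power[OF ratio, of "2 * (r - 1)"] assms(1) by (simp add: power_0_left)
    moreover have "\<forall>\<^sub>F N in sequentially. (\<delta> N / p N powr \<alpha>) ^ (2 * (r - 1)) = ((\<delta> N)\<^sup>2 * p N) ^ (r - 1) / p N ^ (k - 1)"
      using p
    proof eventually_elim
      case (elim N)
      have "(p N powr \<alpha>) ^ (2 * (r - 1)) = p N powr (real (2 * (r - 1)) * \<alpha>)"
        by (rule powr_power[symmetric, THEN sym]) (use elim in auto)
      also have "real (2 * (r - 1)) * \<alpha> = real (k - r)"
        using assms(1,2) by (simp add: \<alpha>_def of_nat_diff)
      also have "p N powr real (k - r) = p N ^ (k - r)" using elim by (simp add: powr_realpow)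
      finally have 1: "(p N powr \<alpha>) ^ (2 * (r - 1)) = p N ^ (k - r)" .
      have "k - 1 = (k - r) + (r - 1)" using assms(1,2) by simp
      then have 2: "p N ^ (k - 1) = p N ^ (k - r) * p N ^ (r - 1)" by (simp only: power_add)
      show ?case unfolding power_divide 1 2 using elim by (simp add: power_mult_distrib power_mult)
    qed
    ultimately show ?thesis by (simp add: tendsto_cong)
  qed
  have regular: "\<forall>\<^sub>F N in sequentially. high_degree_variance (H N) k r N (real C)"
    using assms(4,5,6) eventually_gt_at_top[of 0]
  proof eventually_elim
    case (elim N)
    show ?case
    proof
      fix R assume R: "R \<subseteq> {1..N}" "card R = r"
      have "finite {set_degree (H N) R |R. R \<subseteq> {1..N} \<and> card R = r}"
        by (rule finite_subset[of _ "set_degree (H N) ` Pow {1..N}"]) auto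
      then have "set_degree (H N) R \<le> max_degree r N (H N)"
        unfolding max_degree_def using R by (intro Max_ge) auto
      then show "set_degree (H N) R \<le> real C" using elim(2) by linarith
    qed (use elim assms(1,2,3) in auto)
  qed
  interpret moderate_regime H p \<delta> k r "real C"
    using assms(1,2,3) regular p \<delta>_pos \<delta>_tendsto speed speed_ln cluster by unfold_locales auto
  have *: "exp (- (1 + c) * I N) = exp (- (1 + c) * (\<delta> N)\<^sup>2 * p N * (total_weight (H N))\<^sup>2
                 / (2 * (1 - p N) * ((avg_degree N (H N))\<^sup>2 + degree_variance N (H N)) * real N))" for c N
    unfolding gaussian_rate_def by (simp only: times_divide_eq_right mult.assoc)
  \<comment> \<open>The lower tail is the upper tail of minus the deviation, the case
    \<open>\<sigma> = -1\<close>.\<close>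
  have **: "(\<delta> N * p N ^ k * total_weight (H N) \<le> - 1 * deviation k (p N) (H N) B)
     \<longleftrightarrow> (deviation k (p N) (H N) B \<le> - \<delta> N * p N ^ k * total_weight (H N))" for N B
    by (simp add: algebra_simps) linarith
  show ?thesis
    using tail_asymptotics[of 1] tail_asymptotics[of "- 1"] unfolding * ** mult_1_left by blast
qed

end
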